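(* Let $\nu>-1/2$, $0\le|\beta|<\alpha$, $\mu\in\mathbb{R}$, let $X\sim\mathrm{VG}(\nu,\alpha,\beta,\mu)$ and let $F_X(x)=\mathbb{P}(X\le x)$. Then: (i) for $x\ge\mu$, $$F_X(x)=1-\frac{(1-\beta^2/\alpha^2)^{\nu+1/2}}{2\sqrt{\pi}\,\Gamma(\nu+1/2)}\sum_{k=0}^\infty\frac{1}{k!}\Big(\frac{2\beta}{\alpha}\Big)^k\Gamma\Big(\frac{k+1}{2}\Big)\Gamma\Big(\nu+\frac{k+1}{2}\Big)\tilde{G}_{\nu+k,\nu}(\alpha(x-\mu));$$ (ii) for $x<\mu$, $$F_X(x)=\frac{(1-\beta^2/\alpha^2)^{\nu+1/2}}{2\sqrt{\pi}\,\Gamma(\nu+1/2)}\sum_{k=0}^\infty\frac{(-1)^k}{k!}\Big(\frac{2\beta}{\alpha}\Big)^k\Gamma\Big(\frac{k+1}{2}\Big)\Gamma\Big(\nu+\frac{k+1}{2}\Big)\tilde{G}_{\nu+k,\nu}(-\alpha(x-\mu));$$ (iii) for all $x\in\mathbb{R}$, $$F_X(x)=\frac12-\frac{\Gamma(\nu+1)}{\sqrt{\pi}\,\Gamma(\nu+1/2)}\frac{\beta}{\alpha}\Big(1-\frac{\beta^2}{\alpha^2}\Big)^{\nu+1/2}{}_2F_1\Big(1,\nu+1;\frac32;\frac{\beta^2}{\alpha^2}\Big)$$ $$\qquad+\frac{(1-\beta^2/\alpha^2)^{\nu+1/2}}{2\sqrt{\pi}\,\Gamma(\nu+1/2)}\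sum_{k=0}^\infty\frac{(\mathrm{sgn}(x-\mu))^{k+1}}{k!}\Big(\frac{2\beta}{\alpha}\Big)^k\Gamma\Big(\frac{k+1}{2}\Big)\Gamma\Big(\nu+\frac{k+1}{2}\Big)G_{\nu+k,\nu}(\alpha|x-\mu|).$$
   Context: Variance-gamma distribution: for $\nu>-1/2$, $0\le|\beta|<\alpha$, $\mu\in\mathbb{R}$, $\mathrm{VG}(\nu,\alpha,\beta,\mu)$ is the probability distribution on $\mathbb{R}$ with density $$p(x)=\frac{(\alpha^2-\beta^2)^{\nu+1/2}}{\sqrt{\pi}(2\alpha)^\nu\Gamma(\nu+1/2)}\,\mathrm{e}^{\beta(x-\mu)}|x-\mu|^\nu K_\nu(\alpha|x-\mu|).$$ Modified Bessel function of the second kind: for $\nu\in\mathbb{R}$ and $x>0$, $K_\nu(x)=\int_0^\infty \mathrm{e}^{-x\cosh t}\cosh(\nu t)\,\mathrm{d}t$. Normalised modified Lommel function of the first kind: for $x>0$, $$\tilde t_{\lambda,\nu}(x)=\sum_{k=0}^\infty\frac{(x/2)^{\lambda+2k+1}}{\Gamma\big(k+\frac{\lambda-\nu+3}{2}\big)\Gamma\big(k+\frac{\lambda+\nu+3}{2}\big)}.$$ For $\lambda\ge\nu>-1/2$ and $x>0$, $$G_{\lambda,\nu}(x)=x\big(K_\nu(x)\tilde t_{\lambda-1,\nu-1}(x)+K_{\nu-1}(x)\tilde t_{\lambda,\nu}(x)\big),\qquad \tilde G_{\lambda,\nu}(x)=1-G_{\lambda,\nu}(x).$$ At $x=0$ these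 are understood as limits as $x\downarrow0$, i.e. $G_{\lambda,\nu}(0)=0$ and $\tilde G_{\lambda,\nu}(0)=1$. Gaussian hypergeometric function: ${}_2F_1(a,b;c;x)=\sum_{j=0}^\infty\frac{(a)_j(b)_j}{(c)_j}\frac{x^j}{j!}$ for $|x|<1$, where $(u)_j=u(u+1)\cdots(u+j-1)$, $(u)_0=1$. $\mathrm{sgn}(x)=1$ for $x>0$, $\mathrm{sgn}(0)=0$, $\mathrm{sgn}(x)=-1$ for $x<0$. The convention $0^0=1$ is used for $(2\beta/\alpha)^0$. *)

theory Defs
  imports "HOL-Probability.Probability"
begin

(* Meaningful for x > 0. The integral does not converge at x = 0, where the library value is 0. *)
definition bessel_K :: "real \<Rightarrow> real \<Rightarrow> real" where
  "bessel_K \<nu> x = (LBINT t:{0..}. exp (- (x * cosh t)) * cosh (\<nu> * t))"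

(* At the single point x = \<mu>, where the formula may be undefined or infinite, this evaluates
   to 0; that does not affect the distribution with this density. *)
definition vg_density :: "real \<Rightarrow> real \<Rightarrow> real \<Rightarrow> real \<Rightarrow> real \<Rightarrow> real" where
  "vg_density \<nu> \<alpha> \<beta> \<mu> x =
     (\<alpha>\<^sup>2 - \<beta>\<^sup>2) powr (\<nu> + 1/2) / (sqrt pi * (2 * \<alpha>) powr \<nu> * Gamma (\<nu> + 1/2))
     * exp (\<beta> * (x - \<mu>)) * \<bar>x - \<mu>\<bar> powr \<nu> * bessel_K \<nu> (\<alpha> * \<bar>x - \<mu>\<bar>)"

(* X ~ VG(\<nu>,\<alpha>,\<beta>,\<mu>) for a random variable X on M *)
definition VG_distributed ::
  "'a measure \<Rightarrow> ('a \<Rightarrow> real) \<Rightarrow> real \<Rightarrow> real \<Rightarrow> real \<Rightarrow> real \<Rightarrow> bool" where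
  "VG_distributed M X \<nu> \<alpha> \<beta> \<mu> \<longleftrightarrow>
     distributed M lborel X (\<lambda>x. ennreal (vg_density \<nu> \<alpha> \<beta> \<mu> x))"

definition lommel_t :: "real \<Rightarrow> real \<Rightarrow> real \<Rightarrow> real" where
  "lommel_t l \<nu> x =
     (\<Sum>k. (x / 2) powr (l + 2 * real k + 1)
          / (Gamma (real k + (l - \<nu> + 3) / 2) * Gamma (real k + (l + \<nu> + 3) / 2)))"

(* The value at x = 0 is the limit as x tends to 0 from the right. *)
definition G_fun :: "real \<Rightarrow> real \<Rightarrow> real \<Rightarrow> real" where
  "G_fun l \<nu> x =
     (if x = 0 then 0
      else x * (bessel_K \<nu> x * lommel_t (l - 1) (\<nu> - 1) x
                + bessel_K (\<nu> - 1) x * lommel_t l \<nu> x))"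

definition G_tilde :: "real \<Rightarrow> real \<Rightarrow> real \<Rightarrow> real" where
  "G_tilde l \<nu> x = 1 - G_fun l \<nu> x"

definition hyp2F1 :: "real \<Rightarrow> real \<Rightarrow> real \<Rightarrow> real \<Rightarrow> real" where
  "hyp2F1 a b c x = (\<Sum>j. pochhammer a j * pochhammer b j / pochhammer c j * (x ^ j / fact j))"

end

theory Submission
  imports Defs
begin

text \<open>
The distribution function is obtained by integrating the density term by term, after the factor
\<open>exp (\<beta> * (x - \<mu>))\<close> has been expanded into its power series. Rescaling to \<open>Y = \<alpha> * (X - \<mu>)\<close> leaves the single
parameter \<open>r = \<beta> / \<alpha>\<close>, and the terms are integrals of \<open>u powr (\<nu> + k) * K \<nu> u\<close> over a half line or over an
interval that starts at 0.

These integrals are what the functions \<open>G\<close> and \<open>1 - G\<close> compute. The derivative of \<open>G\<close> is a constant multiple of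
\<open>u powr l * K \<nu> u\<close>, because the derivative rules of the Bessel functions and of the Lommel functions cancel in
all mixed products (\<open>G_fun_deriv\<close>), and \<open>G\<close> vanishes at 0 (\<open>G_fun_tendsto_0\<close>). That the constant makes \<open>G\<close>
tend to 1 at infinity is the Mellin transform of the Bessel function (\<open>nn_integral_powr_bessel_K\<close>), which Tonelli's
theorem reduces to a Beta integral. Hence the integral over \<open>(z, \<infinity>)\<close> is \<open>bessel_K_moment\<close>, a product of two Gamma values
and a power of 2, times \<open>1 - G\<close>, and the one over \<open>(0, z]\<close> is the same product times \<open>G\<close>.

Summation and integration may be exchanged because the partial sums are dominated by
\<open>exp (\<bar>r\<bar> * u) * u powr \<nu> * K \<nu> u\<close>, and this is integrable since the density of \<open>Y\<close> has finite mass on both half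
lines (\<open>std_vg_half_line_probabilities\<close>). Applied to \<open>Y\<close> this gives the expansion to the right of \<open>\<mu>\<close>; applied to \<open>- Y\<close>,
whose parameter is \<open>- r\<close>, it gives the one to the left.

The remaining expansion needs the probability of \<open>X \<le> \<mu>\<close>. The two one-sided expansions give it
as \<open>1 - C * (E + O)\<close> and as \<open>C * (E - O)\<close>, where \<open>E\<close> and \<open>O\<close> are the even and the odd part of the coefficient
series. So \<open>C * E = 1/2\<close> and the probability is \<open>1/2 - C * O\<close>; the odd part is a hypergeometric series in
\<open>r\<^sup>2\<close> (\<open>vg_coeff_odd_part_sums\<close>).
\<close>

section \<open>Bounds for the modified Bessel function of the second kind\<close>

lemma borel_measurable_cosh_real [measurable]: "(cosh :: real \<Rightarrow> real) \<in> borel_measurable borel"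
  by (intro borel_measurable_continuous_onI continuous_intros)

text \<open>One bound serves two purposes: the factor \<open>exp (- (a * t))\<close> makes integrals over \<open>t\<close>
converge and the factor \<open>x powr (- a)\<close> controls \<open>K\<close> as \<open>x\<close> tends to 0. It is
\<open>ln y \<le> y - 1\<close> for \<open>y = x * exp t / (2 * a)\<close>, combined with \<open>cosh t \<ge> exp t / 2\<close>.\<close>
lemma exp_cosh_le:
  fixes a x t :: real
  assumes "a > 0" "x > 0"
  shows "exp (- (x * cosh t)) \<le> (2 * a / x) powr a * exp (- (a * t))"
proof -
  have "t - ln (2 * a / x) = ln (x * exp t / (2 * a))"
    using assms by (simp add: ln_mult ln_div)
  also have "\<dots> \<le> x * exp t / (2 * a) - 1"
    using assms by (intro ln_le_minus_one) auto
  finally have "a * (t - ln (2 * a / x)) \<le> a * (x * exp t / (2 * a) - 1)"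
    using assms by (intro mult_left_mono) auto
  also have "\<dots> \<le> x * (exp t / 2)"
    using assms by (simp add: field_simps)
  also have "\<dots> \<le> x * cosh t"
    using assms by (intro mult_left_mono) (auto simp: cosh_def)
  finally have "exp (- (x * cosh t)) \<le> exp (a * ln (2 * a / x) - a * t)"
    by (simp add: algebra_simps)
  also have "\<dots> = (2 * a / x) powr a * exp (- (a * t))"
    using assms by (simp add: powr_def exp_diff exp_minus field_simps)
  finally show ?thesis .
qed

lemma cosh_mult_le_exp:
  fixes \<nu> t :: real
  assumes "t \<ge> 0"
  shows "cosh (\<nu> * t) \<le> exp (\<bar>\<nu>\<bar> * t)"
proof -
  have "exp (\<nu> * t) \<le> exp (\<bar>\<nu>\<bar> * t)" "exp (- (\<nu> * t)) \<le> exp (\<bar>\<nu>\<bar> * t)"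
    using assms mult_right_mono[of \<nu> "\<bar>\<nu>\<bar>" t] mult_right_mono[of "-\<nu>" "\<bar>\<nu>\<bar>" t] by auto
  from add_mono[OF this] show ?thesis by (simp add: cosh_field_def)
qed

lemma bessel_K_integrand_le:
  fixes \<nu> a x t :: real
  assumes "a > 0" "x > 0" "t \<ge> 0"
  shows "exp (- (x * cosh t)) * cosh (\<nu> * t) \<le> (2 * a / x) powr a * exp (- ((a - \<bar>\<nu>\<bar>) * t))"
proof -
  have "exp (- (x * cosh t)) * cosh (\<nu> * t)
          \<le> ((2 * a / x) powr a * exp (- (a * t))) * exp (\<bar>\<nu>\<bar> * t)"
    using assms by (intro mult_mono exp_cosh_le cosh_mult_le_exp) auto
  also have "\<dots> = (2 * a / x) powr a * exp (- ((a - \<bar>\<nu>\<bar>) * t))"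
    by (simp add: algebra_simps flip: exp_add)
  finally show ?thesis .
qed

lemma exp_decay_integral:
  fixes b :: real
  assumes "b > 0"
  shows "set_integrable lborel {0..} (\<lambda>t. exp (- (b * t)))"
    and "(LBINT t:{0..}. exp (- (b * t))) = 1 / b"
proof -
  have *: "((\<lambda>t. exp (- (b * t))) has_integral 1 / b) {0..}"
    using has_integral_exp_minus_to_infinity[of b 0] assms by simp
  hence "(\<lambda>t. exp (- (b * t))) absolutely_integrable_on {0..}"
    by (intro nonnegative_absolutely_integrable_1) auto
  thus int: "set_integrable lborel {0..} (\<lambda>t. exp (- (b * t)))"
    unfolding set_integrable_def by (subst (asm) integrable_completion) auto
  show "(LBINT t:{0..}. exp (- (b * t))) = 1 / b"
    using set_borel_integral_eq_integral(2)[OF int] * by (simp add: integral_unique)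
qed

lemma bessel_K_set_integrable:
  fixes \<nu> x :: real
  assumes "x > 0"
  shows "set_integrable lborel {0..} (\<lambda>t. exp (- (x * cosh t)) * cosh (\<nu> * t))"
proof -
  define a where "a = \<bar>\<nu>\<bar> + 1"
  have "set_integrable lborel {0..} (\<lambda>t. (2 * a / x) powr a * exp (- (1 * t)))"
    by (intro set_integrable_mult_right exp_decay_integral) auto
  thus ?thesis
  proof (rule set_integrable_bound)
    show "AE t in lborel. t \<in> {0..} \<longrightarrow> norm (exp (- (x * cosh t)) * cosh (\<nu> * t))
            \<le> norm ((2 * a / x) powr a * exp (- (1 * t)))"
      using bessel_K_integrand_le[of a x _ \<nu>] assms by (auto simp: a_def abs_mult)
  qed (auto simp: set_borel_measurable_def)
qed

lemma bessel_K_nonneg: "bessel_K \<nu> x \<ge> 0"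
  unfolding bessel_K_def set_lebesgue_integral_def by (intro integral_nonneg_AE) auto

text \<open>Every exponent \<open>a\<close> above \<open>\<bar>\<nu>\<bar>\<close> is allowed; this room is what makes the boundary terms at 0 vanish later.\<close>
lemma bessel_K_le:
  fixes \<nu> a x :: real
  assumes "x > 0" "a > \<bar>\<nu>\<bar>"
  shows "bessel_K \<nu> x \<le> (2 * a / x) powr a / (a - \<bar>\<nu>\<bar>)"
proof -
  have "bessel_K \<nu> x \<le> (LBINT t:{0..}. (2 * a / x) powr a * exp (- ((a - \<bar>\<nu>\<bar>) * t)))"
    unfolding bessel_K_def using assms
    by (intro set_integral_mono bessel_K_set_integrable set_integrable_mult_right
          exp_decay_integral bessel_K_integrand_le) auto
  also have "\<dots> = (2 * a / x) powr a / (a - \<bar>\<nu>\<bar>)"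
    using assms by (simp add: exp_decay_integral)
  finally show ?thesis .
qed

section \<open>Derivative and recurrence of the Bessel function\<close>

text \<open>Differentiation under the integral sign: by the mean value inequality the dominating function of the
partial derivative also dominates the difference quotients, so dominated convergence applies along every
sequence that tends to the point.\<close>
lemma has_field_derivative_integral_dominated:
  fixes f f' :: "real \<Rightarrow> 'a \<Rightarrow> real" and M :: "'a measure"
  assumes e: "e > 0"
    and g: "integrable M g"
    and f: "\<And>y. \<bar>y - x\<bar> < e \<Longrightarrow> integrable M (f y)"
    and f': "f' x \<in> borel_measurable M"
    and deriv: "\<And>y t. t \<in> space M \<Longrightarrow> \<bar>y - x\<bar> < e \<Longrightarrow> ((\<lambda>y. f y t) has_field_derivative f' y t) (at y)"
    and bound: "\<And>y t. t \<in> space M \<Longrightarrow> \<bar>y - x\<bar> < e \<Longrightarrow> \<bar>f' y t\<bar> \<le> g t"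
  shows "((\<lambda>y. \<integral>t. f y t \<partial>M) has_field_derivative (\<integral>t. f' x t \<partial>M)) (at x)"
  unfolding DERIV_def tendsto_at_iff_sequentially
proof (intro allI impI)
  fix X :: "nat \<Rightarrow> real"
  assume X0: "\<forall>i. X i \<in> UNIV - {0}" and X: "X \<longlonglongrightarrow> 0"
  obtain N where N: "\<And>n. n \<ge> N \<Longrightarrow> \<bar>X n\<bar> < e"
    using X e unfolding LIMSEQ_def by (metis dist_real_def diff_zero)
  \<comment> \<open>The shift by \<open>N\<close> puts all points of the sequence into the neighbourhood where the bound holds.\<close>
  define Y where "Y = (\<lambda>n. X (n + N))"
  have Y: "Y \<longlonglongrightarrow> 0" "\<And>n. \<bar>Y n\<bar> < e" "\<And>n. Y n \<noteq> 0"
    using X0 N LIMSEQ_ignore_initial_segment[OF X, of N] by (auto simp: Y_def)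
  have int: "integrable M (\<lambda>t. (f (x + Y n) t - f x t) / Y n)" for n
    using f[of "x + Y n"] f[of x] Y(2)[of n] e by auto
  have "(\<lambda>n. \<integral>t. (f (x + Y n) t - f x t) / Y n \<partial>M) \<longlonglongrightarrow> (\<integral>t. f' x t \<partial>M)"
  proof (rule integral_dominated_convergence[where w = g])
    show "AE t in M. (\<lambda>n. (f (x + Y n) t - f x t) / Y n) \<longlonglongrightarrow> f' x t"
    proof (rule AE_I2)
      fix t assume "t \<in> space M"
      hence "((\<lambda>h. (f (x + h) t - f x t) / h) \<longlongrightarrow> f' x t) (at 0)"
        using deriv[of t x] e by (simp add: DERIV_def)
      thus "(\<lambda>n. (f (x + Y n) t - f x t) / Y n) \<longlonglongrightarrow> f' x t"
        using Y(1,3) unfolding tendsto_at_iff_sequentially by (auto simp: comp_def)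
    qed
    show "AE t in M. norm ((f (x + Y n) t - f x t) / Y n) \<le> g t" for n
    proof (rule AE_I2)
      fix t assume t: "t \<in> space M"
      have "norm (f (x + Y n) t - f x t) \<le> g t * norm (x + Y n - x)"
      proof (rule field_differentiable_bound[where S = "ball x e" and f' = "\<lambda>y. f' y t"])
        fix z assume z: "z \<in> ball x e"
        hence z': "\<bar>z - x\<bar> < e" by (simp add: dist_real_def abs_minus_commute)
        show "((\<lambda>y. f y t) has_field_derivative f' z t) (at z within ball x e)"
          using deriv[OF t z'] by (rule has_field_derivative_at_within)
        show "norm (f' z t) \<le> g t" using bound[OF t z'] by simp
      qed (use e Y(2)[of n] in \<open>auto simp: dist_real_def\<close>)
      thus "norm ((f (x + Y n) t - f x t) / Y n) \<le> g t"
        using Y(3)[of n] by (simp add: field_simps)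
    qed
  qed (use g f' int in auto)
  also have "(\<lambda>n. \<integral>t. (f (x + Y n) t - f x t) / Y n \<partial>M)
      = (\<lambda>n. ((\<integral>t. f (x + Y n) t \<partial>M) - (\<integral>t. f x t \<partial>M)) / Y n)"
    using f Y(2) e by (intro ext) (simp add: Bochner_Integration.integral_diff)
  finally have "(\<lambda>n. (\<lambda>h. ((\<integral>t. f (x + h) t \<partial>M) - (\<integral>t. f x t \<partial>M)) / h) (X (n + N)))
      \<longlonglongrightarrow> (\<integral>t. f' x t \<partial>M)" by (simp add: Y_def)
  thus "((\<lambda>h. ((\<integral>t. f (x + h) t \<partial>M) - (\<integral>t. f x t \<partial>M)) / h) \<circ> X) \<longlonglongrightarrow> (\<integral>t. f' x t \<partial>M)"
    unfolding comp_def by (rule LIMSEQ_offset)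
qed

text \<open>The two product formulas turn the factors \<open>cosh t\<close> and \<open>sinh t\<close>, which appear when the kernel is
differentiated in \<open>x\<close> or in \<open>t\<close>, into shifts of the order \<open>\<nu>\<close> by one.\<close>
lemma cosh_mult_cosh:
  fixes \<nu> t :: real
  shows "cosh t * cosh (\<nu> * t) = (cosh ((\<nu> + 1) * t) + cosh ((\<nu> - 1) * t)) / 2"
  by (simp add: algebra_simps cosh_add cosh_diff)

lemma sinh_mult_sinh:
  fixes \<nu> t :: real
  shows "sinh t * sinh (\<nu> * t) = (cosh ((\<nu> + 1) * t) - cosh ((\<nu> - 1) * t)) / 2"
  by (simp add: algebra_simps cosh_add cosh_diff)

lemma bessel_K_integrals_lincomb:
  fixes a b c x :: real
  assumes "x > 0"
  shows "set_integrable lborel {0..} (\<lambda>t. exp (- (x * cosh t)) *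
           (a * cosh (\<nu> * t) + b * cosh ((\<nu> + 1) * t) + c * cosh ((\<nu> - 1) * t)))"
    and "(LBINT t:{0..}. exp (- (x * cosh t)) *
           (a * cosh (\<nu> * t) + b * cosh ((\<nu> + 1) * t) + c * cosh ((\<nu> - 1) * t)))
         = a * bessel_K \<nu> x + b * bessel_K (\<nu> + 1) x + c * bessel_K (\<nu> - 1) x"
proof -
  let ?e = "\<lambda>\<nu> t. exp (- (x * cosh t)) * cosh (\<nu> * t)"
  have eq: "exp (- (x * cosh t)) *
           (a * cosh (\<nu> * t) + b * cosh ((\<nu> + 1) * t) + c * cosh ((\<nu> - 1) * t))
           = a * ?e \<nu> t + b * ?e (\<nu> + 1) t + c * ?e (\<nu> - 1) t" for t
    by (simp add: algebra_simps)
  note int = bessel_K_set_integrable[OF assms]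
  show "set_integrable lborel {0..} (\<lambda>t. exp (- (x * cosh t)) *
           (a * cosh (\<nu> * t) + b * cosh ((\<nu> + 1) * t) + c * cosh ((\<nu> - 1) * t)))"
    unfolding eq by (intro set_integral_add(1) set_integrable_mult_right int)
  show "(LBINT t:{0..}. exp (- (x * cosh t)) *
           (a * cosh (\<nu> * t) + b * cosh ((\<nu> + 1) * t) + c * cosh ((\<nu> - 1) * t)))
         = a * bessel_K \<nu> x + b * bessel_K (\<nu> + 1) x + c * bessel_K (\<nu> - 1) x"
    unfolding eq bessel_K_def
    by (simp only: set_integral_add set_integrable_mult_right int set_integral_mult_right)
qed

lemma bessel_K_deriv_neighbours:
  fixes \<nu> x :: real
  assumes x: "x > 0"
  shows "(bessel_K \<nu> has_field_derivative - (bessel_K (\<nu> + 1) x + bessel_K (\<nu> - 1) x) / 2) (at x)"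
proof -
  let ?w = "\<lambda>y t. exp (- (y * cosh t)) * (0 * cosh (\<nu> * t) + 1/2 * cosh ((\<nu> + 1) * t) + 1/2 * cosh ((\<nu> - 1) * t))"
  have w: "?w y t = exp (- (y * cosh t)) * (cosh t * cosh (\<nu> * t))" for y t
    by (simp add: cosh_mult_cosh)
  have "((\<lambda>y. \<integral>t. indicator {0..} t *\<^sub>R (exp (- (y * cosh t)) * cosh (\<nu> * t)) \<partial>lborel)
          has_field_derivative (\<integral>t. - (indicator {0..} t *\<^sub>R ?w x t) \<partial>lborel)) (at x)"
  \<comment> \<open>The kernel decreases in \<open>x\<close>, so its value at \<open>x / 2\<close> dominates on a neighbourhood of \<open>x\<close>.\<close>
  proof (rule has_field_derivative_integral_dominated[where e = "x / 2" and g = "\<lambda>t. indicator {0..} t *\<^sub>R ?w (x/2) t"])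
    show "integrable lborel (\<lambda>t. indicator {0..} t *\<^sub>R ?w (x/2) t)"
      using bessel_K_integrals_lincomb(1)[of "x/2" 0 \<nu> "1/2" "1/2"] x unfolding set_integrable_def by simp
    fix y assume y: "\<bar>y - x\<bar> < x / 2"
    show "integrable lborel (\<lambda>t. indicator {0..} t *\<^sub>R (exp (- (y * cosh t)) * cosh (\<nu> * t)))"
      using bessel_K_set_integrable[of y \<nu>] y unfolding set_integrable_def by linarith
    fix t :: real
    show "((\<lambda>y. indicator {0..} t *\<^sub>R (exp (- (y * cosh t)) * cosh (\<nu> * t))) has_field_derivative
            - (indicator {0..} t *\<^sub>R ?w y t)) (at y)"
      unfolding w by (auto intro!: derivative_eq_intros)
    have "x / 2 * cosh t \<le> y * cosh t" using y by (intro mult_right_mono) (auto simp: abs_if split: if_splits)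
    thus "\<bar>- (indicator {0..} t *\<^sub>R ?w y t)\<bar> \<le> indicator {0..} t *\<^sub>R ?w (x/2) t"
      unfolding w by (auto simp: abs_mult indicator_def intro!: mult_right_mono)
  qed (use x in auto)
  moreover have eq: "(\<integral>t. - (indicator {0..} t *\<^sub>R ?w x t) \<partial>lborel) = - (bessel_K (\<nu> + 1) x + bessel_K (\<nu> - 1) x) / 2"
    using bessel_K_integrals_lincomb(2)[OF x, of 0 \<nu> "1/2" "1/2"]
    by (simp add: set_lebesgue_integral_def)
  moreover have "bessel_K \<nu> = (\<lambda>y. \<integral>t. indicator {0..} t *\<^sub>R (exp (- (y * cosh t)) * cosh (\<nu> * t)) \<partial>lborel)"
    by (simp add: fun_eq_iff bessel_K_def set_lebesgue_integral_def)
  ultimately show ?thesis by (simp only: eq)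
qed

text \<open>Integration by parts: the integrand below is the derivative of \<open>exp (- (x * cosh t)) * sinh (\<nu> * t)\<close>,
which vanishes at 0 and at infinity.\<close>
lemma bessel_K_recurrence:
  fixes \<nu> x :: real
  assumes x: "x > 0"
  shows "bessel_K (\<nu> + 1) x - bessel_K (\<nu> - 1) x = 2 * \<nu> / x * bessel_K \<nu> x"
proof -
  let ?F = "\<lambda>t. exp (- (x * cosh t)) * sinh (\<nu> * t)"
  let ?f = "\<lambda>t. exp (- (x * cosh t)) * (\<nu> * cosh (\<nu> * t) + (- (x / 2)) * cosh ((\<nu> + 1) * t) + x / 2 * cosh ((\<nu> - 1) * t))"
  note int = bessel_K_integrals_lincomb[OF x, of \<nu> \<nu> "- (x / 2)" "x / 2"]
  have f: "?f t = exp (- (x * cosh t)) * (\<nu> * cosh (\<nu> * t) - x * (sinh t * sinh (\<nu> * t)))" for t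
    by (simp add: sinh_mult_sinh field_simps)
  have "(LBINT t=ereal 0..\<infinity>. ?f t) = 0 - ?F 0"
  proof (rule interval_integral_FTC_integrable)
    fix t :: real
    show "(?F has_vector_derivative ?f t) (at t)"
      unfolding f has_real_derivative_iff_has_vector_derivative[symmetric]
      by (auto intro!: derivative_eq_intros simp: algebra_simps)
    show "isCont ?f t" by (auto intro!: continuous_intros)
  next
    show "set_integrable lborel (einterval (ereal 0) \<infinity>) ?f"
      by (rule set_integrable_subset[OF int(1)]) (auto simp: einterval_def)
    show "((?F \<circ> real_of_ereal) \<longlongrightarrow> ?F 0) (at_right (ereal 0))"
      unfolding ereal_tendsto_simps
      by (rule tendsto_eq_rhs[OF isCont_tendsto_compose]) (auto intro!: tendsto_eq_intros)
    show "((?F \<circ> real_of_ereal) \<longlongrightarrow> 0) (at_left \<infinity>)"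
      unfolding ereal_tendsto_simps
    proof (rule Lim_null_comparison)
      let ?a = "\<bar>\<nu>\<bar> + 1"
      show "eventually (\<lambda>t. norm (?F t) \<le> (2 * ?a / x) powr ?a * exp (- t)) at_top"
      proof (rule eventually_mono[OF eventually_ge_at_top[of 0]])
        fix t :: real assume t: "t \<ge> 0"
        have "\<bar>sinh (\<nu> * t)\<bar> \<le> cosh (\<nu> * t)"
          by (rule abs_leI) (simp_all add: sinh_field_def cosh_field_def field_simps)
        hence "norm (?F t) \<le> exp (- (x * cosh t)) * cosh (\<nu> * t)" by (simp add: abs_mult)
        also have "\<dots> \<le> (2 * ?a / x) powr ?a * exp (- t)"
          using bessel_K_integrand_le[of ?a x t \<nu>] x t by simp
        finally show "norm (?F t) \<le> (2 * ?a / x) powr ?a * exp (- t)" .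
      qed
      have "((\<lambda>t::real. exp (- t)) \<longlongrightarrow> 0) at_top"
        by (rule filterlim_compose[OF exp_at_bot filterlim_uminus_at_bot_at_top])
      thus "((\<lambda>t. (2 * ?a / x) powr ?a * exp (- t)) \<longlongrightarrow> 0) at_top"
        by (rule tendsto_mult_right_zero)
    qed
  qed auto
  hence "(LBINT t:{0<..}. ?f t) = 0" by (simp add: interval_integral_to_infinity_eq)
  moreover have "(LBINT t:{0..}. ?f t) = (LBINT t:{0<..}. ?f t)"
    unfolding set_lebesgue_integral_def
    by (intro integral_cong_AE) (auto intro!: eventually_mono[OF AE_lborel_singleton[of "0::real"]] simp: indicator_def)
  ultimately show ?thesis using int(2) x by (simp add: field_simps)
qed

text \<open>The two forms are those for which \<open>x powr \<nu> * K \<nu> x\<close> and \<open>x powr (- \<nu>) * K \<nu> x\<close> have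
derivatives with a single Bessel function in them.\<close>
lemma bessel_K_deriv:
  fixes \<nu> x :: real
  assumes x: "x > 0"
  shows "(bessel_K \<nu> has_field_derivative - bessel_K (\<nu> - 1) x - \<nu> / x * bessel_K \<nu> x) (at x)"
    and "(bessel_K \<nu> has_field_derivative - bessel_K (\<nu> + 1) x + \<nu> / x * bessel_K \<nu> x) (at x)"
proof -
  have *: "- (bessel_K (\<nu> + 1) x + bessel_K (\<nu> - 1) x) / 2 = - bessel_K (\<nu> - 1) x - \<nu> / x * bessel_K \<nu> x"
          "- (bessel_K (\<nu> + 1) x + bessel_K (\<nu> - 1) x) / 2 = - bessel_K (\<nu> + 1) x + \<nu> / x * bessel_K \<nu> x"
    using bessel_K_recurrence[OF x, of \<nu>] by (simp_all add: field_simps)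
  show "(bessel_K \<nu> has_field_derivative - bessel_K (\<nu> - 1) x - \<nu> / x * bessel_K \<nu> x) (at x)"
    using bessel_K_deriv_neighbours[OF x, of \<nu>] unfolding *(1) .
  show "(bessel_K \<nu> has_field_derivative - bessel_K (\<nu> + 1) x + \<nu> / x * bessel_K \<nu> x) (at x)"
    using bessel_K_deriv_neighbours[OF x, of \<nu>] unfolding *(2) .
qed

lemma isCont_bessel_K: "x > 0 \<Longrightarrow> isCont (bessel_K \<nu>) x"
  using bessel_K_deriv(1) DERIV_isCont by blast

lemma continuous_on_bessel_K: "continuous_on {0<..} (bessel_K \<nu>)"
  by (auto intro!: continuous_at_imp_continuous_on isCont_bessel_K)

section \<open>The power series of the modified Lommel functions\<close>

text \<open>Up to a power of \<open>x\<close>, a normalised Lommel function is this entire function at \<open>y = x\<^sup>2 / 4\<close>. The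
parametrisation by \<open>p\<close> and \<open>q\<close> is symmetric, and the two contiguous Lommel functions that occur in
\<open>G\<close> differ only in \<open>q\<close>.\<close>
definition lommel_series :: "real \<Rightarrow> real \<Rightarrow> real \<Rightarrow> real" where
  "lommel_series p q y = (\<Sum>k. 1 / (Gamma (real k + p) * Gamma (real k + q)) * y ^ k)"

lemma lommel_series_commute: "lommel_series p q = lommel_series q p"
  by (simp add: lommel_series_def fun_eq_iff mult.commute)

lemma Gamma_add_1_pos:
  fixes z :: real
  assumes "z > 0"
  shows "Gamma (z + 1) = z * Gamma z"
  using assms by (intro Gamma_plus1) (auto elim: nonpos_Ints_cases)

text \<open>The quotient of consecutive terms is \<open>y / ((k + p) * (k + q))\<close>, which is at most one half once
\<open>k \<ge> 2 * \<bar>y\<bar>\<close>.\<close>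
lemma summable_lommel_series:
  fixes p q y :: real
  assumes "p > 0" "q > 0"
  shows "summable (\<lambda>k. 1 / (Gamma (real k + p) * Gamma (real k + q)) * y ^ k)"
proof (rule summable_ratio_test)
  show "(1/2::real) < 1" by simp
  fix k :: nat
  assume "k \<ge> nat \<lceil>2 * \<bar>y\<bar>\<rceil> + 1"
  hence k: "real k \<ge> 2 * \<bar>y\<bar>" "real k \<ge> 1" by linarith+
  let ?D = "Gamma (real k + p) * Gamma (real k + q)"
  let ?d = "(real k + p) * (real k + q)"
  have "Gamma (real (Suc k) + p) = (real k + p) * Gamma (real k + p)"
       "Gamma (real (Suc k) + q) = (real k + q) * Gamma (real k + q)"
    using assms Gamma_add_1_pos[of "real k + p"] Gamma_add_1_pos[of "real k + q"]
    by (simp_all add: add_ac)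
  hence eq: "1 / (Gamma (real (Suc k) + p) * Gamma (real (Suc k) + q)) * y ^ Suc k
        = y / ?d * (1 / ?D * y ^ k)"
    by simp
  have "2 * \<bar>y\<bar> * 1 \<le> ?d"
    using k assms by (intro mult_mono) auto
  moreover have d: "?d > 0" using assms by simp
  ultimately have "\<bar>y / ?d\<bar> \<le> 1 / 2" by (simp add: abs_mult field_simps)
  thus "norm (1 / (Gamma (real (Suc k) + p) * Gamma (real (Suc k) + q)) * y ^ Suc k)
          \<le> 1/2 * norm (1 / ?D * y ^ k)"
    unfolding eq real_norm_def abs_mult[of "y / ?d"] by (intro mult_right_mono) auto
qed

text \<open>Equivalently, \<open>y powr (q - 1)\<close> times the series has a derivative of the same kind with \<open>q\<close> lowered by one:
the factor \<open>k + q - 1\<close> from differentiation is absorbed by the functional equation of Gamma.\<close>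
lemma lommel_series_deriv:
  fixes p q y :: real
  assumes "p > 0" "q > 1" "y > 0"
  shows "(lommel_series p q has_field_derivative
           (lommel_series p (q - 1) y - (q - 1) * lommel_series p q y) / y) (at y)"
proof -
  define c where "c = (\<lambda>k. 1 / (Gamma (real k + p) * Gamma (real k + q)))"
  have c: "summable (\<lambda>k. c k * z ^ k)" for z
    using summable_lommel_series[of p q z] assms by (simp add: c_def)
  have "summable (\<lambda>k. diffs c k * y ^ k)"
    by (rule termdiff_converges_all) (use c in auto)
  hence "(\<lambda>k. real k * c k * y ^ (k - Suc 0)) sums (\<Sum>k. diffs c k * y ^ k)"
    by (rule diffs_equiv)
  from sums_add[OF sums_mult2[OF this, of y] sums_mult[OF summable_sums[OF c[of y]], of "q - 1"]]
  have "(\<lambda>k. real k * c k * y ^ (k - Suc 0) * y + (q - 1) * (c k * y ^ k)) sums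
          ((\<Sum>k. diffs c k * y ^ k) * y + (q - 1) * lommel_series p q y)"
    by (simp add: lommel_series_def c_def)
  also have "(\<lambda>k. real k * c k * y ^ (k - Suc 0) * y + (q - 1) * (c k * y ^ k))
      = (\<lambda>k. 1 / (Gamma (real k + p) * Gamma (real k + (q - 1))) * y ^ k)"
  proof
    fix k
    have "real k * c k * y ^ (k - Suc 0) * y = real k * c k * y ^ k"
      by (cases k) auto
    hence "real k * c k * y ^ (k - Suc 0) * y + (q - 1) * (c k * y ^ k)
            = (real k + q - 1) * c k * y ^ k"
      by (simp add: algebra_simps)
    also have "(real k + q - 1) * c k = 1 / (Gamma (real k + p) * Gamma (real k + (q - 1)))"
      using assms Gamma_add_1_pos[of "real k + (q - 1)"] by (simp add: c_def add_diff_eq)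
    finally show "real k * c k * y ^ (k - Suc 0) * y + (q - 1) * (c k * y ^ k)
            = 1 / (Gamma (real k + p) * Gamma (real k + (q - 1))) * y ^ k" .
  qed
  finally have "lommel_series p (q - 1) y = (\<Sum>k. diffs c k * y ^ k) * y + (q - 1) * lommel_series p q y"
    by (simp add: lommel_series_def sums_iff)
  hence "(\<Sum>k. diffs c k * y ^ k) = (lommel_series p (q - 1) y - (q - 1) * lommel_series p q y) / y"
    using assms by (simp add: field_simps)
  moreover have "((\<lambda>z. \<Sum>k. c k * z ^ k) has_field_derivative (\<Sum>k. diffs c k * y ^ k)) (at y)"
    by (rule termdiffs_strong_converges_everywhere) (rule c)
  ultimately show ?thesis by (simp add: lommel_series_def[abs_def] c_def)
qed

lemma lommel_series_split_head:
  fixes p q y :: real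
  assumes "p > 0" "q > 0"
  shows "lommel_series p q y = 1 / (Gamma p * Gamma q) + y * lommel_series (p + 1) (q + 1) y"
proof -
  have "lommel_series p q y = 1 / (Gamma p * Gamma q)
          + (\<Sum>k. 1 / (Gamma (real (Suc k) + p) * Gamma (real (Suc k) + q)) * y ^ Suc k)"
    unfolding lommel_series_def using suminf_split_head[OF summable_lommel_series[OF assms, of y]] by simp
  also have "(\<Sum>k. 1 / (Gamma (real (Suc k) + p) * Gamma (real (Suc k) + q)) * y ^ Suc k)
        = (\<Sum>k. y * (1 / (Gamma (real k + (p + 1)) * Gamma (real k + (q + 1))) * y ^ k))"
    by (simp add: add_ac mult_ac)
  also have "\<dots> = y * lommel_series (p + 1) (q + 1) y"
    unfolding lommel_series_def using assms by (intro suminf_mult summable_lommel_series) auto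
  finally show ?thesis .
qed

lemma isCont_lommel_series:
  fixes p q y :: real
  assumes "p > 0" "q > 0"
  shows "isCont (lommel_series p q) y"
proof -
  have "isCont (\<lambda>y. \<Sum>k. 1 / (Gamma (real k + p) * Gamma (real k + q)) * y ^ k) y"
    by (rule isCont_powser_converges_everywhere) (rule summable_lommel_series[OF assms])
  thus ?thesis by (simp add: lommel_series_def[abs_def])
qed

lemma lommel_t_eq:
  fixes l \<nu> x :: real
  assumes "x > 0" "l - \<nu> + 3 > 0" "l + \<nu> + 3 > 0"
  shows "lommel_t l \<nu> x = (x / 2) powr (l + 1) * lommel_series ((l - \<nu> + 3) / 2) ((l + \<nu> + 3) / 2) ((x / 2)\<^sup>2)"
proof -
  have "(x / 2) powr (l + 2 * real k + 1) = (x / 2) powr (l + 1) * ((x / 2)\<^sup>2) ^ k" for k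
  proof -
    have "(x / 2) powr (l + 2 * real k + 1) = (x / 2) powr (l + 1 + real (2 * k))"
      by (simp add: add_ac)
    also have "\<dots> = (x / 2) powr (l + 1) * ((x / 2)\<^sup>2) ^ k"
      using assms by (subst powr_add, subst powr_realpow) (auto simp: power_mult)
    finally show ?thesis .
  qed
  hence "lommel_t l \<nu> x = (\<Sum>k. (x / 2) powr (l + 1) * (1 / (Gamma (real k + (l - \<nu> + 3) / 2) *
           Gamma (real k + (l + \<nu> + 3) / 2)) * ((x / 2)\<^sup>2) ^ k))"
    by (simp add: lommel_t_def)
  also have "\<dots> = (x / 2) powr (l + 1) * lommel_series ((l - \<nu> + 3) / 2) ((l + \<nu> + 3) / 2) ((x / 2)\<^sup>2)"
    unfolding lommel_series_def using assms by (intro suminf_mult summable_lommel_series) auto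
  finally show ?thesis .
qed

section \<open>The function G as an antiderivative\<close>

lemma G_fun_eq:
  fixes l \<nu> x :: real
  assumes "x > 0" "\<nu> > -1/2" "l \<ge> \<nu>"
  defines "p \<equiv> (l - \<nu> + 3) / 2" and "q \<equiv> (l + \<nu> + 3) / 2"
  shows "G_fun l \<nu> x = 2 * (bessel_K \<nu> x * ((x / 2) powr (l + 1) * lommel_series p (q - 1) ((x / 2)\<^sup>2))
                           + bessel_K (\<nu> - 1) x * ((x / 2) powr (l + 2) * lommel_series p q ((x / 2)\<^sup>2)))"
proof -
  have 1: "lommel_t (l - 1) (\<nu> - 1) x = (x / 2) powr l * lommel_series p (q - 1) ((x / 2)\<^sup>2)"
    using lommel_t_eq[of x "l - 1" "\<nu> - 1"] assms by (simp add: p_def q_def field_simps)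
  have 2: "lommel_t l \<nu> x = (x / 2) powr (l + 1) * lommel_series p q ((x / 2)\<^sup>2)"
    using lommel_t_eq[of x l \<nu>] assms by (simp add: p_def q_def)
  have e: "x * (x / 2) powr l = 2 * (x / 2) powr (l + 1)" "x * (x / 2) powr (l + 1) = 2 * (x / 2) powr (l + 2)"
    using assms(1) powr_add[of "x / 2" l 1] powr_add[of "x / 2" "l + 1" 1] by (simp_all add: add_ac mult_ac)
  have d: "x * (K * (u * L) + K' * (v * L')) = K * (x * u * L) + K' * (x * v * L')" for K K' u v L L' :: real
    by (simp add: algebra_simps)
  have "G_fun l \<nu> x = x * (bessel_K \<nu> x * ((x / 2) powr l * lommel_series p (q - 1) ((x / 2)\<^sup>2))
                   + bessel_K (\<nu> - 1) x * ((x / 2) powr (l + 1) * lommel_series p q ((x / 2)\<^sup>2)))"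
    unfolding G_fun_def 1 2 using assms(1) by simp
  thus ?thesis unfolding d e by (simp add: algebra_simps)
qed

text \<open>This turns out to be the Mellin transform of the Bessel function, the integral of
\<open>u powr l * K \<nu> u\<close> over the positive half line.\<close>
definition bessel_K_moment :: "real \<Rightarrow> real \<Rightarrow> real" where
  "bessel_K_moment l \<nu> = 2 powr (l - 1) * Gamma ((l - \<nu> + 1) / 2) * Gamma ((l + \<nu> + 1) / 2)"

lemma bessel_K_moment_pos:
  assumes "\<nu> > -1/2" "l \<ge> \<nu>"
  shows "bessel_K_moment l \<nu> > 0"
  using assms unfolding bessel_K_moment_def by (intro mult_pos_pos Gamma_real_pos) auto

text \<open>\<open>G\<close> is, up to a factor 2, the sum of two products of a Bessel function and a Lommel term. With suitable
powers of \<open>x\<close> as weights, differentiation exchanges the two Bessel functions with a minus sign and the two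
Lommel terms with a plus sign, so all products cancel, except for one term: one of the two derivatives produces
the Lommel series for \<open>p - 1\<close> and \<open>q - 1\<close>, which exceeds \<open>h\<^sup>2\<close> times the series for \<open>p\<close> and \<open>q\<close> by
its head \<open>c\<close>.\<close>
lemma G_fun_deriv:
  fixes l \<nu> x :: real
  assumes x: "x > 0" and \<nu>: "\<nu> > -1/2" "l \<ge> \<nu>"
  shows "(G_fun l \<nu> has_field_derivative x powr l * bessel_K \<nu> x / bessel_K_moment l \<nu>) (at x)"
proof -
  define p where "p = (l - \<nu> + 3) / 2"
  define q where "q = (l + \<nu> + 3) / 2"
  have pq: "p > 1" "q > 1" using \<nu> by (auto simp: p_def q_def)
  define h where "h = x / 2"
  define H where "H = h powr l"
  define A where "A = lommel_series p (q - 1) (h\<^sup>2)"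
  define B where "B = lommel_series p q (h\<^sup>2)"
  define c where "c = 1 / (Gamma (p - 1) * Gamma (q - 1))"
  have h: "h > 0" "x = 2 * h" using x by (auto simp: h_def)
  have dq: "((\<lambda>x. (x / 2)\<^sup>2) has_field_derivative h) (at x)"
    by (auto intro!: derivative_eq_intros simp: h_def)
  have head: "lommel_series (p - 1) (q - 1) (h\<^sup>2) = c + h\<^sup>2 * B"
    using lommel_series_split_head[of "p - 1" "q - 1" "h\<^sup>2"] pq by (simp add: c_def B_def)
  have "(lommel_series p (q - 1) has_field_derivative
          (lommel_series (p - 1) (q - 1) (h\<^sup>2) - (p - 1) * A) / h\<^sup>2) (at ((x / 2)\<^sup>2))"
    using lommel_series_deriv[of "q - 1" p "h\<^sup>2"] pq h(1)
    by (simp add: lommel_series_commute[of "q - 1"] A_def h_def)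
  from DERIV_chain2[OF this dq]
  have dA: "((\<lambda>x. lommel_series p (q - 1) ((x / 2)\<^sup>2)) has_field_derivative (c + h\<^sup>2 * B - (p - 1) * A) / h) (at x)"
    unfolding head using h by (simp add: power2_eq_square)
  have "(lommel_series p q has_field_derivative (A - (q - 1) * B) / h\<^sup>2) (at ((x / 2)\<^sup>2))"
    using lommel_series_deriv[of p q "h\<^sup>2"] pq h(1) by (simp add: A_def B_def h_def)
  from DERIV_chain2[OF this dq]
  have dB: "((\<lambda>x. lommel_series p q ((x / 2)\<^sup>2)) has_field_derivative (A - (q - 1) * B) / h) (at x)"
    using h by (simp add: power2_eq_square)
  have dpow: "((\<lambda>x. (x / 2) powr a) has_field_derivative a / 2 * h powr (a - 1)) (at x)" for a
    using x by (auto intro!: derivative_eq_intros simp: h_def)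
  have H: "h powr (l + 1) = H * h" "h powr (l + 2) = H * h\<^sup>2"
    using h(1) powr_realpow[of h 2] by (simp_all add: H_def powr_add)
  have d1: "((\<lambda>x. (x / 2) powr (l + 1) * lommel_series p (q - 1) ((x / 2)\<^sup>2)) has_field_derivative
             H * (c + h\<^sup>2 * B + \<nu> / 2 * A)) (at x)"
  proof (rule DERIV_cong[OF DERIV_mult[OF dpow dA]])
    have "p - 1 = (l + 1) / 2 - \<nu> / 2" by (simp add: p_def field_simps)
    moreover have "(c + h\<^sup>2 * B - (p - 1) * A) / h * (H * h) = (c + h\<^sup>2 * B - (p - 1) * A) * H"
      using h(1) by simp
    ultimately have "(l + 1) / 2 * H * A + (c + h\<^sup>2 * B - (p - 1) * A) / h * (H * h)
                      = H * (c + h\<^sup>2 * B + \<nu> / 2 * A)"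
      by (simp only:) (simp add: algebra_simps)
    moreover have "h powr (l + 1 - 1) = H" by (simp add: H_def)
    ultimately show "(l + 1) / 2 * h powr (l + 1 - 1) * lommel_series p (q - 1) ((x / 2)\<^sup>2) +
            (c + h\<^sup>2 * B - (p - 1) * A) / h * (x / 2) powr (l + 1) = H * (c + h\<^sup>2 * B + \<nu> / 2 * A)"
      unfolding h_def[symmetric] A_def[symmetric] H by (simp only:)
  qed
  have d2: "((\<lambda>x. (x / 2) powr (l + 2) * lommel_series p q ((x / 2)\<^sup>2)) has_field_derivative
             H * h * (A + (1 - \<nu>) / 2 * B)) (at x)"
  proof (rule DERIV_cong[OF DERIV_mult[OF dpow dB]])
    have "q - 1 = (l + 2) / 2 - (1 - \<nu>) / 2" by (simp add: q_def field_simps)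
    moreover have "(A - (q - 1) * B) / h * (H * h\<^sup>2) = (A - (q - 1) * B) * (H * h)"
      using h(1) by (simp add: power2_eq_square)
    ultimately have "(l + 2) / 2 * (H * h) * B + (A - (q - 1) * B) / h * (H * h\<^sup>2)
                      = H * h * (A + (1 - \<nu>) / 2 * B)"
      by (simp only:) (simp add: algebra_simps)
    moreover have "l + 2 - 1 = l + 1" by simp
    ultimately show "(l + 2) / 2 * h powr (l + 2 - 1) * lommel_series p q ((x / 2)\<^sup>2) +
            (A - (q - 1) * B) / h * (x / 2) powr (l + 2) = H * h * (A + (1 - \<nu>) / 2 * B)"
      unfolding h_def[symmetric] B_def[symmetric] by (simp only: H)
  qed
  let ?G = "\<lambda>x. 2 * (bessel_K \<nu> x * ((x / 2) powr (l + 1) * lommel_series p (q - 1) ((x / 2)\<^sup>2))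
                   + bessel_K (\<nu> - 1) x * ((x / 2) powr (l + 2) * lommel_series p q ((x / 2)\<^sup>2)))"
  have "(?G has_field_derivative 2 * (bessel_K \<nu> x * H * c)) (at x)"
  proof (rule DERIV_cong[OF DERIV_cmult[OF DERIV_add[OF
          DERIV_mult[OF bessel_K_deriv(1)[OF x] d1] DERIV_mult[OF bessel_K_deriv(2)[OF x] d2]]]])
    let ?K = "bessel_K \<nu> x" and ?K1 = "bessel_K (\<nu> - 1) x"
    \<comment> \<open>Naming these quotients leaves a polynomial identity.\<close>
    define n where "n = \<nu> / x"
    define m where "m = (\<nu> - 1) / x"
    have nm: "\<nu> / 2 = n * h" "(1 - \<nu>) / 2 = - m * h"
      using h by (simp_all add: n_def m_def field_simps)
    have "(- ?K1 - \<nu> / x * ?K) * (H * h * A) + H * (c + h\<^sup>2 * B + \<nu> / 2 * A) * ?K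
         + ((- ?K + (\<nu> - 1) / x * ?K1) * (H * h\<^sup>2 * B) + H * h * (A + (1 - \<nu>) / 2 * B) * ?K1)
         = ?K * H * c"
      unfolding nm n_def[symmetric] m_def[symmetric] by (simp add: algebra_simps power2_eq_square)
    thus "2 * ((- ?K1 - \<nu> / x * ?K) * ((x / 2) powr (l + 1) * lommel_series p (q - 1) ((x / 2)\<^sup>2))
         + H * (c + h\<^sup>2 * B + \<nu> / 2 * A) * ?K
         + ((- bessel_K (\<nu> - 1 + 1) x + (\<nu> - 1) / x * ?K1) * ((x / 2) powr (l + 2) * lommel_series p q ((x / 2)\<^sup>2))
         + H * h * (A + (1 - \<nu>) / 2 * B) * ?K1)) = 2 * (?K * H * c)"
      unfolding h_def[symmetric] A_def[symmetric] B_def[symmetric] H by simp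
  qed
  hence "(G_fun l \<nu> has_field_derivative 2 * (bessel_K \<nu> x * H * c)) (at x)"
    by (rule has_field_derivative_transform_within_open[where S = "{0<..}"])
       (use x \<nu> in \<open>simp_all add: G_fun_eq p_def q_def\<close>)
  also have "2 * (bessel_K \<nu> x * H * c) = x powr l * bessel_K \<nu> x / bessel_K_moment l \<nu>"
  proof -
    have "2 * H = x powr l / 2 powr (l - 1)"
      using x by (simp add: H_def h_def powr_divide powr_diff)
    moreover have "p - 1 = (l - \<nu> + 1) / 2" "q - 1 = (l + \<nu> + 1) / 2"
      by (simp_all add: p_def q_def field_simps)
    moreover have "2 * (bessel_K \<nu> x * H * c) = bessel_K \<nu> x * (2 * H) * c" by simp
    ultimately show ?thesis unfolding c_def bessel_K_moment_def by (simp only:) (simp add: mult_ac)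
  qed
  finally show ?thesis .
qed

text \<open>The bound by \<open>x powr (- b)\<close> is used with \<open>b\<close> strictly between \<open>\<bar>\<nu>\<bar>\<close> and \<open>a\<close>.\<close>
lemma powr_times_bessel_K_tendsto_0:
  fixes \<nu> a :: real
  assumes "a > \<bar>\<nu>\<bar>"
  shows "((\<lambda>x. (x / 2) powr a * bessel_K \<nu> x) \<longlongrightarrow> 0) (at_right 0)"
proof -
  define b where "b = (a + \<bar>\<nu>\<bar>) / 2"
  have b: "\<bar>\<nu>\<bar> < b" "b < a" using assms by (auto simp: b_def)
  show ?thesis
  proof (rule Lim_null_comparison)
    show "eventually (\<lambda>x. norm ((x / 2) powr a * bessel_K \<nu> x)
            \<le> b powr b / (b - \<bar>\<nu>\<bar>) * (x / 2) powr (a - b)) (at_right 0)"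
    proof (rule eventually_mono[OF eventually_at_right_less])
      fix x :: real assume x: "0 < x"
      have "norm ((x / 2) powr a * bessel_K \<nu> x) \<le> (x / 2) powr a * ((2 * b / x) powr b / (b - \<bar>\<nu>\<bar>))"
        using mult_left_mono[OF bessel_K_le[OF x b(1)], of "(x / 2) powr a"] by (simp add: abs_mult bessel_K_nonneg)
      also have "2 * b / x = b / (x / 2)" by simp
      also have "(b / (x / 2)) powr b = b powr b / (x / 2) powr b"
        using x b by (intro powr_divide)
      finally show "norm ((x / 2) powr a * bessel_K \<nu> x)
            \<le> b powr b / (b - \<bar>\<nu>\<bar>) * (x / 2) powr (a - b)"
        by (simp add: powr_diff mult_ac)
    qed
    have "((\<lambda>x::real. (x / 2) powr (a - b)) \<longlongrightarrow> 0) (at_right 0)"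
      by (rule tendsto_zero_powrI[where b = "a - b"])
         (use b in \<open>auto intro!: tendsto_eq_intros eventually_mono[OF eventually_at_right_less]\<close>)
    thus "((\<lambda>x. b powr b / (b - \<bar>\<nu>\<bar>) * (x / 2) powr (a - b)) \<longlongrightarrow> 0) (at_right 0)"
      by (rule tendsto_mult_right_zero)
  qed
qed

text \<open>The powers that accompany the two Bessel functions in \<open>G\<close> are \<open>l + 1\<close> and \<open>l + 2\<close>; the hypotheses on
\<open>\<nu>\<close> and \<open>l\<close> give \<open>\<bar>\<nu>\<bar> < l + 1\<close> and \<open>\<bar>\<nu> - 1\<bar> < l + 2\<close>.\<close>
lemma G_fun_tendsto_0:
  fixes l \<nu> :: real
  assumes \<nu>: "\<nu> > -1/2" "l \<ge> \<nu>"
  shows "(G_fun l \<nu> \<longlongrightarrow> 0) (at_right 0)"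
proof -
  define p where "p = (l - \<nu> + 3) / 2"
  define q where "q = (l + \<nu> + 3) / 2"
  have pq: "p > 1" "q > 1" using \<nu> by (auto simp: p_def q_def)
  have lim: "((\<lambda>x. lommel_series p q' ((x / 2)\<^sup>2)) \<longlongrightarrow> lommel_series p q' 0) (at_right 0)" if "q' > 0" for q'
    by (rule isCont_tendsto_compose[OF isCont_lommel_series])
       (use pq that in \<open>auto intro!: tendsto_eq_intros\<close>)
  have "((\<lambda>x. 2 * ((x / 2) powr (l + 1) * bessel_K \<nu> x * lommel_series p (q - 1) ((x / 2)\<^sup>2)
                 + (x / 2) powr (l + 2) * bessel_K (\<nu> - 1) x * lommel_series p q ((x / 2)\<^sup>2)))
           \<longlongrightarrow> 2 * (0 * lommel_series p (q - 1) 0 + 0 * lommel_series p q 0)) (at_right 0)"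
    using \<nu> pq by (intro tendsto_intros lim powr_times_bessel_K_tendsto_0) auto
  hence "((\<lambda>x. 2 * ((x / 2) powr (l + 1) * bessel_K \<nu> x * lommel_series p (q - 1) ((x / 2)\<^sup>2)
                 + (x / 2) powr (l + 2) * bessel_K (\<nu> - 1) x * lommel_series p q ((x / 2)\<^sup>2)))
           \<longlongrightarrow> 0) (at_right 0)" by simp
  thus ?thesis
    by (rule Lim_transform_eventually)
       (use \<nu> in \<open>auto intro!: eventually_mono[OF eventually_at_right_less] simp: G_fun_eq p_def q_def mult_ac\<close>)
qed

lemma bessel_K_power_integral_Ioo:
  fixes l \<nu> z :: real
  assumes z: "z > 0" and \<nu>: "\<nu> > -1/2" "l \<ge> \<nu>"
  shows "set_integrable lborel {0<..<z} (\<lambda>u. u powr l * bessel_K \<nu> u)"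
    and "(LBINT u:{0<..<z}. u powr l * bessel_K \<nu> u) = bessel_K_moment l \<nu> * G_fun l \<nu> z"
proof -
  let ?N = "bessel_K_moment l \<nu>"
  have N: "?N > 0" using \<nu> by (rule bessel_K_moment_pos)
  have *: "ereal 0 < ereal z" using z by simp
  have F: "((\<lambda>x. ?N * G_fun l \<nu> x) has_field_derivative x powr l * bessel_K \<nu> x) (at x)" if "x > 0" for x
    using DERIV_cmult[OF G_fun_deriv[OF that \<nu>], of ?N] N by simp
  have "isCont (\<lambda>x. ?N * G_fun l \<nu> x) z" using F[OF z] by (rule DERIV_isCont)
  hence z': "((\<lambda>x. ?N * G_fun l \<nu> x) \<longlongrightarrow> ?N * G_fun l \<nu> z) (at_left z)"
    by (simp add: isCont_def filterlim_at_split)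
  have 0: "((\<lambda>x. ?N * G_fun l \<nu> x) \<longlongrightarrow> 0) (at_right 0)"
    using G_fun_tendsto_0[OF \<nu>] by (rule tendsto_mult_right_zero)
  have cont: "isCont (\<lambda>x. x powr l * bessel_K \<nu> x) x" if "x > 0" for x
    using that by (intro continuous_intros isCont_bessel_K) auto
  note ftc = interval_integral_FTC_nonneg[OF *, where F = "\<lambda>x. ?N * G_fun l \<nu> x"
      and f = "\<lambda>x. x powr l * bessel_K \<nu> x" and A = 0 and B = "?N * G_fun l \<nu> z"]
  show "set_integrable lborel {0<..<z} (\<lambda>u. u powr l * bessel_K \<nu> u)"
    using ftc(1) F z' 0 cont by (auto simp: ereal_tendsto_simps bessel_K_nonneg)
  have "(LBINT x=ereal 0..ereal z. x powr l * bessel_K \<nu> x) = ?N * G_fun l \<nu> z"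
    using ftc(2) F z' 0 cont by (auto simp: ereal_tendsto_simps bessel_K_nonneg)
  thus "(LBINT u:{0<..<z}. u powr l * bessel_K \<nu> u) = ?N * G_fun l \<nu> z"
    using z by (simp add: interval_lebesgue_integral_def)
qed

section \<open>The Mellin transform of the Bessel function\<close>

lemma nn_integral_lborel_fold:
  fixes f :: "real \<Rightarrow> ennreal"
  assumes [measurable]: "f \<in> borel_measurable borel"
  shows "(\<integral>\<^sup>+x. f x \<partial>lborel) = (\<integral>\<^sup>+x. indicator {0<..} x * (f x + f (- x)) \<partial>lborel)"
proof -
  have "(\<integral>\<^sup>+x. f x \<partial>lborel) = (\<integral>\<^sup>+x. indicator {0<..} x * f x + indicator {..<0} x * f x \<partial>lborel)"
    by (intro nn_integral_cong_AE eventually_mono[OF AE_lborel_singleton[of "0::real"]])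
       (auto simp: indicator_def)
  also have "\<dots> = (\<integral>\<^sup>+x. indicator {0<..} x * f x \<partial>lborel) + (\<integral>\<^sup>+x. indicator {..<0} x * f x \<partial>lborel)"
    by (intro nn_integral_add) auto
  also have "(\<integral>\<^sup>+x. indicator {..<0} x * f x \<partial>lborel) = (\<integral>\<^sup>+x. indicator {0<..} x * f (- x) \<partial>lborel)"
    by (subst nn_integral_real_affine[where c = "-1" and t = 0])
       (auto simp: indicator_def intro!: nn_integral_cong)
  also have "(\<integral>\<^sup>+x. indicator {0<..} x * f x \<partial>lborel) + (\<integral>\<^sup>+x. indicator {0<..} x * f (- x) \<partial>lborel)
        = (\<integral>\<^sup>+x. indicator {0<..} x * (f x + f (- x)) \<partial>lborel)"
    by (subst nn_integral_add [symmetric]) (auto simp: distrib_left)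
  finally show ?thesis .
qed

lemma nn_integral_powr_exp:
  fixes c s :: real
  assumes s: "s > 0" and c: "c > 0"
  shows "(\<integral>\<^sup>+u. ennreal (indicator {0<..} u * (u powr (s - 1) * exp (- (u * c)))) \<partial>lborel)
         = ennreal (Gamma s * c powr (- s))"
proof -
  let ?I = "\<integral>\<^sup>+u. ennreal (indicator {0<..} u * (u powr (s - 1) * exp (- (u * c)))) \<partial>lborel"
  have "ennreal (Gamma s) = (\<integral>\<^sup>+t. ennreal (indicator {0..} t * t powr (s - 1) / exp t) \<partial>lborel)"
    using Gamma_conv_nn_integral_real[OF s] .
  also have "\<dots> = ennreal c * (\<integral>\<^sup>+u. ennreal (indicator {0..} (c * u) * (c * u) powr (s - 1) / exp (c * u)) \<partial>lborel)"
    using c by (subst nn_integral_real_affine[where c = c and t = 0]) auto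
  also have "(\<integral>\<^sup>+u. ennreal (indicator {0..} (c * u) * (c * u) powr (s - 1) / exp (c * u)) \<partial>lborel)
      = (\<integral>\<^sup>+u. ennreal (c powr (s - 1)) * ennreal (indicator {0<..} u * (u powr (s - 1) * exp (- (u * c)))) \<partial>lborel)"
    using c by (intro nn_integral_cong_AE eventually_mono[OF AE_lborel_singleton[of "0::real"]])
       (auto simp: indicator_def powr_mult exp_minus field_simps zero_le_mult_iff simp flip: ennreal_mult')
  also have "\<dots> = ennreal (c powr (s - 1)) * ?I"
    by (intro nn_integral_cmult) auto
  finally have "ennreal (Gamma s) = ennreal c * (ennreal (c powr (s - 1)) * ?I)" .
  hence "ennreal (c powr (- s)) * ennreal (Gamma s) = ennreal (c powr (- s)) * (ennreal c * (ennreal (c powr (s - 1)) * ?I))"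
    by simp
  also have "\<dots> = ennreal (c powr (- s) * (c * c powr (s - 1))) * ?I"
    using c by (simp add: ennreal_mult' mult.assoc)
  also have "c powr (- s) * (c * c powr (s - 1)) = 1"
    using c by (simp add: powr_diff powr_minus field_simps)
  finally show ?thesis
    using c s by (simp add: ennreal_mult'[symmetric] mult.commute)
qed

text \<open>The logistic substitution \<open>u = 1 / (1 + exp (- 2 * t))\<close> carries the real line to the unit interval. Since
\<open>u = exp t / (2 * cosh t)\<close> and \<open>1 - u = exp (- t) / (2 * cosh t)\<close>, the Beta integrand becomes an
exponential times a power of \<open>cosh\<close>.\<close>
lemma Beta_eq_nn_integral_cosh:
  fixes \<nu> s :: real
  assumes s: "s > \<bar>\<nu>\<bar>"
  shows "(\<integral>\<^sup>+t. ennreal (2 * (exp (\<nu> * t) * (2 * cosh t) powr (- s))) \<partial>lborel)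
         = ennreal (Beta ((s + \<nu>) / 2) ((s - \<nu>) / 2))"
proof -
  define a where "a = (s + \<nu>) / 2"
  define b where "b = (s - \<nu>) / 2"
  have ab: "a > 0" "b > 0" "a + b = s" "a - b = \<nu>"
    using s by (auto simp: a_def b_def field_simps)
  define f where "f = (\<lambda>u::real. u powr (a - 1) * (1 - u) powr (b - 1))"
  define g where "g = (\<lambda>t::real. 1 / (1 + exp (- (2 * t))))"
  have pos: "1 + exp (- (2 * t)) > 0" for t :: real
    by (simp add: add_pos_pos)
  have g: "g t = exp t / (2 * cosh t)" "1 - g t = exp (- t) / (2 * cosh t)" for t
  proof -
    have "exp (- (2 * t)) = exp (- t) / exp t"
      by (simp add: exp_diff[symmetric])
    hence "1 + exp (- (2 * t)) = 2 * cosh t / exp t"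
      by (simp add: cosh_field_def add_divide_distrib)
    thus eq: "g t = exp t / (2 * cosh t)" by (simp add: g_def)
    have "1 - exp t / (2 * cosh t) = (2 * cosh t - exp t) / (2 * cosh t)"
      by (simp add: diff_divide_distrib)
    moreover have "2 * cosh t - exp t = exp (- t)" by (simp add: cosh_field_def add_divide_distrib)
    ultimately show "1 - g t = exp (- t) / (2 * cosh t)" unfolding eq by (simp only:)
  qed
  have g01: "g t > 0" "g t < 1" for t
    using pos[of t] by (simp_all add: g_def)
  have dg: "(g has_field_derivative 2 * (g t * (1 - g t))) (at t within UNIV)" for t
  proof -
    have "(g has_field_derivative 2 * exp (- (2 * t)) / (1 + exp (- (2 * t)))\<^sup>2) (at t)"
      unfolding g_def using pos[of t]
      by (auto intro!: derivative_eq_intros simp: power2_eq_square)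
    also have "2 * exp (- (2 * t)) / (1 + exp (- (2 * t)))\<^sup>2 = 2 * (g t * (1 - g t))"
      using pos[of t] by (simp add: g_def power2_eq_square field_simps)
    finally show ?thesis .
  qed
  have inj: "inj_on g UNIV"
    by (rule injI) (use pos in \<open>auto simp: g_def field_simps\<close>)
  have range: "range g = {0<..<1}"
  proof (intro equalityI subsetI)
    fix u :: real assume u: "u \<in> {0<..<1}"
    have "g (ln (u / (1 - u)) / 2) = u"
      using u by (simp add: g_def exp_minus field_simps)
    thus "u \<in> range g" by (metis rangeI)
  qed (use g01 in auto)
  have hi: "(f has_integral Beta a b) {0<..<1}"
    unfolding f_def using has_integral_Beta_real[OF ab(1,2)] by (simp add: has_integral_Icc_iff_Ioo)
  hence "f absolutely_integrable_on {0<..<1}"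
    by (intro nonnegative_absolutely_integrable_1) (auto simp: f_def)
  hence "(\<lambda>t. \<bar>2 * (g t * (1 - g t))\<bar> * f (g t)) absolutely_integrable_on UNIV \<and>
        integral UNIV (\<lambda>t. \<bar>2 * (g t * (1 - g t))\<bar> * f (g t)) = Beta a b"
    using has_absolute_integral_change_of_variables_1'[of UNIV g "\<lambda>t. 2 * (g t * (1 - g t))" f "Beta a b"]
      dg inj hi unfolding range by (auto simp: integral_unique)
  hence "((\<lambda>t. \<bar>2 * (g t * (1 - g t))\<bar> * f (g t)) has_integral Beta a b) UNIV"
    by (metis set_lebesgue_integral_eq_integral(1) has_integral_integrable_integral)
  also have "(\<lambda>t. \<bar>2 * (g t * (1 - g t))\<bar> * f (g t)) = (\<lambda>t. 2 * (exp (\<nu> * t) * (2 * cosh t) powr (- s)))"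
  proof
    fix t
    have "\<bar>2 * (g t * (1 - g t))\<bar> * f (g t) = 2 * (g t powr a * (1 - g t) powr b)"
      using g01[of t] by (simp add: f_def abs_mult powr_diff)
    also have "\<dots> = 2 * (exp (a * t - b * t) / ((2 * cosh t) powr (a + b)))"
    proof -
      have "exp x powr y = exp (y * x)" for x y :: real by (simp add: powr_def)
      hence "g t powr a * (1 - g t) powr b
              = (exp (a * t) * exp (- (b * t))) / ((2 * cosh t) powr a * (2 * cosh t) powr b)"
        unfolding g(2) unfolding g(1) by (simp add: powr_divide)
      thus ?thesis by (simp add: powr_add flip: exp_add)
    qed
    also have "a * t - b * t = \<nu> * t" using ab by (simp add: algebra_simps flip: left_diff_distrib)
    finally show "\<bar>2 * (g t * (1 - g t))\<bar> * f (g t) = 2 * (exp (\<nu> * t) * (2 * cosh t) powr (- s))"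
      by (simp add: ab powr_minus field_simps)
  qed
  finally show ?thesis
    unfolding a_def b_def by (intro nn_integral_has_integral_lborel) auto
qed

lemma nn_integral_cosh_cosh_powr:
  fixes \<nu> s :: real
  assumes s: "s > \<bar>\<nu>\<bar>"
  shows "(\<integral>\<^sup>+t. ennreal (indicator {0<..} t * (cosh (\<nu> * t) * cosh t powr (- s))) \<partial>lborel)
         = ennreal (2 powr (s - 2) * Beta ((s + \<nu>) / 2) ((s - \<nu>) / 2))"
proof -
  let ?I = "\<integral>\<^sup>+t. ennreal (indicator {0<..} t * (cosh (\<nu> * t) * cosh t powr (- s))) \<partial>lborel"
  have "ennreal (Beta ((s + \<nu>) / 2) ((s - \<nu>) / 2))
      = (\<integral>\<^sup>+t. indicator {0<..} t * (ennreal (2 * (exp (\<nu> * t) * (2 * cosh t) powr (- s)))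
          + ennreal (2 * (exp (\<nu> * - t) * (2 * cosh (- t)) powr (- s)))) \<partial>lborel)"
    unfolding Beta_eq_nn_integral_cosh[OF s, symmetric]
    by (rule nn_integral_lborel_fold) measurable
  also have "\<dots> = (\<integral>\<^sup>+t. ennreal (2 powr (2 - s)) * ennreal (indicator {0<..} t * (cosh (\<nu> * t) * cosh t powr (- s))) \<partial>lborel)"
  proof (intro nn_integral_cong)
    fix t :: real
    have "ennreal (2 * (exp (\<nu> * t) * (2 * cosh t) powr (- s))) + ennreal (2 * (exp (\<nu> * - t) * (2 * cosh (- t)) powr (- s)))
        = ennreal (2 * (exp (\<nu> * t) * (2 * cosh t) powr (- s)) + 2 * (exp (\<nu> * - t) * (2 * cosh (- t)) powr (- s)))"
      by (intro ennreal_plus[symmetric]) auto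
    also have "2 * (exp (\<nu> * t) * (2 * cosh t) powr (- s)) + 2 * (exp (\<nu> * - t) * (2 * cosh (- t)) powr (- s))
          = 4 * (cosh (\<nu> * t) * (2 * cosh t) powr (- s))"
      by (simp add: cosh_field_def[of "\<nu> * t"] field_simps)
    also have "\<dots> = 2 powr (2 - s) * (cosh (\<nu> * t) * cosh t powr (- s))"
      by (simp add: powr_mult) (simp add: powr_diff powr_minus divide_inverse)
    finally have eq: "ennreal (2 * (exp (\<nu> * t) * (2 * cosh t) powr (- s))) + ennreal (2 * (exp (\<nu> * - t) * (2 * cosh (- t)) powr (- s)))
        = ennreal (2 powr (2 - s) * (cosh (\<nu> * t) * cosh t powr (- s)))" .
    show "indicator {0<..} t * (ennreal (2 * (exp (\<nu> * t) * (2 * cosh t) powr (- s)))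
          + ennreal (2 * (exp (\<nu> * - t) * (2 * cosh (- t)) powr (- s))))
        = ennreal (2 powr (2 - s)) * ennreal (indicator {0<..} t * (cosh (\<nu> * t) * cosh t powr (- s)))"
      unfolding eq by (simp add: indicator_def ennreal_mult')
  qed
  also have "\<dots> = ennreal (2 powr (2 - s)) * ?I"
    by (intro nn_integral_cmult) measurable
  finally have "ennreal (2 powr (s - 2)) * ennreal (Beta ((s + \<nu>) / 2) ((s - \<nu>) / 2))
       = ennreal (2 powr (s - 2)) * (ennreal (2 powr (2 - s)) * ?I)" by simp
  also have "\<dots> = ennreal (2 powr (s - 2) * 2 powr (2 - s)) * ?I"
    by (simp add: ennreal_mult' mult.assoc)
  also have "2 powr (s - 2) * 2 powr (2 - s) = (1::real)"
    by (simp flip: powr_add)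
  finally show ?thesis by (simp add: ennreal_mult')
qed

text \<open>By Tonelli the integration over \<open>u\<close> can be done first. It gives a Gamma function and the power
\<open>cosh t powr (- (l + 1))\<close>, and the remaining integral over \<open>t\<close> is a Beta function.\<close>
lemma nn_integral_powr_bessel_K:
  fixes l \<nu> :: real
  assumes l: "l + 1 > \<bar>\<nu>\<bar>"
  shows "(\<integral>\<^sup>+u. ennreal (indicator {0<..} u * (u powr l * bessel_K \<nu> u)) \<partial>lborel)
         = ennreal (bessel_K_moment l \<nu>)"
proof -
  define s where "s = l + 1"
  have s: "s > 0" "s > \<bar>\<nu>\<bar>" using l by (auto simp: s_def)
  let ?\<Phi> = "\<lambda>u t. ennreal (indicator {0<..} u * (u powr l * exp (- (u * cosh t))))
                * ennreal (indicator {0<..} t * cosh (\<nu> * t))"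
  have "(\<integral>\<^sup>+u. ennreal (indicator {0<..} u * (u powr l * bessel_K \<nu> u)) \<partial>lborel)
      = (\<integral>\<^sup>+u. \<integral>\<^sup>+t. ?\<Phi> u t \<partial>lborel \<partial>lborel)"
  proof (intro nn_integral_cong)
    fix u :: real
    show "ennreal (indicator {0<..} u * (u powr l * bessel_K \<nu> u)) = (\<integral>\<^sup>+t. ?\<Phi> u t \<partial>lborel)"
    proof (cases "u > 0")
      case True
      have "ennreal (bessel_K \<nu> u) = (\<integral>\<^sup>+t. ennreal (indicator {0..} t *\<^sub>R (exp (- (u * cosh t)) * cosh (\<nu> * t))) \<partial>lborel)"
        unfolding bessel_K_def set_lebesgue_integral_def
        using bessel_K_set_integrable[OF True, of \<nu>]
        by (intro nn_integral_eq_integral[symmetric]) (auto simp: set_integrable_def)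
      hence "ennreal (indicator {0<..} u * (u powr l * bessel_K \<nu> u))
         = ennreal (u powr l) * (\<integral>\<^sup>+t. ennreal (indicator {0..} t *\<^sub>R (exp (- (u * cosh t)) * cosh (\<nu> * t))) \<partial>lborel)"
        using True by (simp add: ennreal_mult')
      also have "\<dots> = (\<integral>\<^sup>+t. ennreal (u powr l) * ennreal (indicator {0..} t *\<^sub>R (exp (- (u * cosh t)) * cosh (\<nu> * t))) \<partial>lborel)"
        by (intro nn_integral_cmult[symmetric]) measurable
      also have "\<dots> = (\<integral>\<^sup>+t. ?\<Phi> u t \<partial>lborel)"
        using True by (intro nn_integral_cong_AE eventually_mono[OF AE_lborel_singleton[of "0::real"]])
          (auto simp: indicator_def mult.assoc simp flip: ennreal_mult')
      finally show ?thesis .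
    qed auto
  qed
  also have "\<dots> = (\<integral>\<^sup>+t. \<integral>\<^sup>+u. ?\<Phi> u t \<partial>lborel \<partial>lborel)"
    by (rule lborel_pair.Fubini') measurable
  also have "\<dots> = (\<integral>\<^sup>+t. ennreal (Gamma s) * ennreal (indicator {0<..} t * (cosh (\<nu> * t) * cosh t powr (- s))) \<partial>lborel)"
  proof (intro nn_integral_cong)
    fix t :: real
    have "(\<integral>\<^sup>+u. ?\<Phi> u t \<partial>lborel)
        = (\<integral>\<^sup>+u. ennreal (indicator {0<..} u * (u powr l * exp (- (u * cosh t)))) \<partial>lborel) * ennreal (indicator {0<..} t * cosh (\<nu> * t))"
      by (intro nn_integral_multc) measurable
    also have "\<dots> = ennreal (Gamma s * cosh t powr (- s)) * ennreal (indicator {0<..} t * cosh (\<nu> * t))"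
      using nn_integral_powr_exp[of s "cosh t"] s by (simp add: s_def)
    finally show "(\<integral>\<^sup>+u. ?\<Phi> u t \<partial>lborel)
        = ennreal (Gamma s) * ennreal (indicator {0<..} t * (cosh (\<nu> * t) * cosh t powr (- s)))"
      using s by (simp add: indicator_def mult_ac flip: ennreal_mult')
  qed
  also have "\<dots> = ennreal (Gamma s) * ennreal (2 powr (s - 2) * Beta ((s + \<nu>) / 2) ((s - \<nu>) / 2))"
    unfolding nn_integral_cosh_cosh_powr[OF s(2), symmetric] by (intro nn_integral_cmult) measurable
  also have "\<dots> = ennreal (Gamma s * (2 powr (s - 2) * Beta ((s + \<nu>) / 2) ((s - \<nu>) / 2)))"
    using s by (simp add: ennreal_mult')
  also have "Gamma s * (2 powr (s - 2) * Beta ((s + \<nu>) / 2) ((s - \<nu>) / 2)) = bessel_K_moment l \<nu>"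
  proof -
    have "(s + \<nu>) / 2 + (s - \<nu>) / 2 = s" by (simp add: field_simps)
    moreover have "Gamma s > 0" using s by simp
    moreover have "(s - \<nu>) / 2 = (l - \<nu> + 1) / 2" "(s + \<nu>) / 2 = (l + \<nu> + 1) / 2" "s - 2 = l - 1"
      by (simp_all add: s_def)
    ultimately show ?thesis unfolding Beta_def bessel_K_moment_def by (simp only:) (simp add: mult_ac)
  qed
  finally show ?thesis .
qed

lemma bessel_K_power_integral_Ioi:
  fixes l \<nu> :: real
  assumes \<nu>: "\<nu> > -1/2" "l \<ge> \<nu>"
  shows "set_integrable lborel {0<..} (\<lambda>u. u powr l * bessel_K \<nu> u)"
    and "(LBINT u:{0<..}. u powr l * bessel_K \<nu> u) = bessel_K_moment l \<nu>"
proof -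
  have "continuous_on {0<..} (\<lambda>u. u powr l * bessel_K \<nu> u)"
    by (rule continuous_on_mult[OF continuous_on_powr[OF continuous_on_id continuous_on_const] continuous_on_bessel_K]) auto
  hence "(\<lambda>u. indicator {0<..} u *\<^sub>R (u powr l * bessel_K \<nu> u)) \<in> borel_measurable borel"
    by (rule borel_measurable_continuous_on_indicator[rotated]) auto
  hence meas: "(\<lambda>u. indicator {0<..} u *\<^sub>R (u powr l * bessel_K \<nu> u)) \<in> borel_measurable lborel"
    by simp
  have eq: "(\<integral>\<^sup>+u. ennreal (indicator {0<..} u *\<^sub>R (u powr l * bessel_K \<nu> u)) \<partial>lborel)
            = ennreal (bessel_K_moment l \<nu>)"
    using nn_integral_powr_bessel_K[of \<nu> l] \<nu> by simp
  have nn: "AE u in lborel. 0 \<le> indicator {0<..} u *\<^sub>R (u powr l * bessel_K \<nu> u)"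
    by (auto simp: bessel_K_nonneg)
  show "set_integrable lborel {0<..} (\<lambda>u. u powr l * bessel_K \<nu> u)"
    unfolding set_integrable_def by (rule integrableI_nonneg[OF meas nn]) (simp only: eq, simp)
  show "(LBINT u:{0<..}. u powr l * bessel_K \<nu> u) = bessel_K_moment l \<nu>"
    unfolding set_lebesgue_integral_def integral_eq_nn_integral[OF meas nn] eq
    using bessel_K_moment_pos[OF \<nu>] by simp
qed

text \<open>The head is the fundamental theorem of calculus, and the tail is the total mass minus the head. In particular
\<open>G\<close> rises from 0 to 1, which is what the normalisation of the Lommel functions achieves.\<close>
lemma bessel_K_power_integral_tail_and_head:
  fixes l \<nu> z :: real
  assumes z: "z \<ge> 0" and \<nu>: "\<nu> > -1/2" "l \<ge> \<nu>"
  shows "(LBINT u:{z<..}. u powr l * bessel_K \<nu> u) = bessel_K_moment l \<nu> * G_tilde l \<nu> z"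
    and "(LBINT u:{0<..z}. u powr l * bessel_K \<nu> u) = bessel_K_moment l \<nu> * G_fun l \<nu> z"
proof -
  let ?f = "\<lambda>u. u powr l * bessel_K \<nu> u"
  have int: "set_integrable lborel A ?f" if "A \<subseteq> {0<..}" "A \<in> sets lborel" for A
    using set_integrable_subset[OF bessel_K_power_integral_Ioi(1)[OF \<nu>] that(2,1)] .
  have bm: "set_borel_measurable lborel A ?f" if "A \<subseteq> {0<..}" "A \<in> sets lborel" for A
    using int[OF that] unfolding set_borel_measurable_def set_integrable_def by (rule borel_measurable_integrable)
  show le: "(LBINT u:{0<..z}. ?f u) = bessel_K_moment l \<nu> * G_fun l \<nu> z"
  proof (cases "z = 0")
    case False
    have "(LBINT u:{0<..z}. ?f u) = (LBINT u:{0<..<z}. ?f u)"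
    proof (rule set_integral_cong_set)
      show "set_borel_measurable lborel {0<..z} ?f"
        by (rule bm) auto
      show "set_borel_measurable lborel {0<..<z} ?f"
        by (rule bm) auto
      show "AE x in lborel. (x \<in> {0<..<z}) = (x \<in> {0<..z})"
        by (rule eventually_mono[OF AE_lborel_singleton[of z]]) auto
    qed
    thus ?thesis using bessel_K_power_integral_Ioo(2)[OF _ \<nu>, of z] z False by simp
  qed (simp add: G_fun_def set_lebesgue_integral_def)
  have "(LBINT u:{0<..z} \<union> {z<..}. ?f u) = (LBINT u:{0<..z}. ?f u) + (LBINT u:{z<..}. ?f u)"
  proof (rule set_integral_Un)
    show "set_integrable lborel {0<..z} ?f" "set_integrable lborel {z<..} ?f"
      by (rule int; use z in auto)+
  qed auto
  also have "{0<..z} \<union> {z<..} = {0<..}" using z by auto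
  finally have "(LBINT u:{z<..}. ?f u) = bessel_K_moment l \<nu> - bessel_K_moment l \<nu> * G_fun l \<nu> z"
    unfolding bessel_K_power_integral_Ioi(2)[OF \<nu>] le by linarith
  thus "(LBINT u:{z<..}. ?f u) = bessel_K_moment l \<nu> * G_tilde l \<nu> z"
    by (simp add: G_tilde_def right_diff_distrib)
qed

section \<open>Expansion of the probabilities of half lines\<close>

text \<open>On the positive half line all partial sums of the exponential series of \<open>r * u\<close> are dominated by
\<open>exp (\<bar>r\<bar> * u)\<close>.\<close>
lemma exp_weighted_integral_sums:
  fixes w :: "real \<Rightarrow> real" and r :: real
  assumes A: "A \<in> sets borel" "A \<subseteq> {0<..}"
    and w: "\<And>u. w u \<ge> 0"
    and int: "set_integrable lborel A (\<lambda>u. exp (\<bar>r\<bar> * u) * w u)"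
    and mom: "\<And>k. set_integrable lborel A (\<lambda>u. u ^ k * w u)"
    and meas: "set_borel_measurable lborel A (\<lambda>u. exp (r * u) * w u)"
  shows "(\<lambda>k. r ^ k / fact k * (LBINT u:A. u ^ k * w u)) sums (LBINT u:A. exp (r * u) * w u)"
proof -
  let ?s = "\<lambda>n u. \<Sum>k<n. indicator A u *\<^sub>R (r ^ k / fact k * (u ^ k * w u))"
  have intk: "integrable lborel (\<lambda>u. indicator A u *\<^sub>R (r ^ k / fact k * (u ^ k * w u)))" for k
    using set_integrable_mult_right[OF mom[of k], of "r ^ k / fact k"] unfolding set_integrable_def by simp
  have exp_sums: "(\<lambda>k. (r * u) ^ k / fact k) sums exp (r * u)" for r u :: real
    using exp_converges[of "r * u"] by (simp add: divide_inverse mult.commute)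
  have s: "?s n u = indicator A u * ((\<Sum>k<n. (r * u) ^ k / fact k) * w u)" for n u
    by (simp add: sum_distrib_left sum_distrib_right power_mult_distrib mult_ac)
  have "(\<lambda>n. \<integral>u. ?s n u \<partial>lborel) \<longlonglongrightarrow> (LBINT u:A. exp (r * u) * w u)"
    unfolding set_lebesgue_integral_def
  proof (rule integral_dominated_convergence[where w = "\<lambda>u. indicator A u *\<^sub>R (exp (\<bar>r\<bar> * u) * w u)"])
    show "AE u in lborel. (\<lambda>n. ?s n u) \<longlonglongrightarrow> indicator A u *\<^sub>R (exp (r * u) * w u)"
      unfolding s using exp_sums[of r] by (auto intro!: AE_I2 tendsto_intros simp: sums_def)
    show "AE u in lborel. norm (?s n u) \<le> indicator A u *\<^sub>R (exp (\<bar>r\<bar> * u) * w u)" for n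
    proof (rule AE_I2)
      fix u :: real
      show "norm (?s n u) \<le> indicator A u *\<^sub>R (exp (\<bar>r\<bar> * u) * w u)"
      proof (cases "u \<in> A")
        case True
        hence u: "u > 0" using A by auto
        have "\<bar>\<Sum>k<n. (r * u) ^ k / fact k\<bar> \<le> (\<Sum>k<n. (\<bar>r\<bar> * u) ^ k / fact k)"
          by (rule order.trans[OF sum_abs]) (use u in \<open>simp add: power_abs abs_mult\<close>)
        also have "\<dots> \<le> exp (\<bar>r\<bar> * u)"
          using exp_sums[of "\<bar>r\<bar>" u] u by (simp add: sums_iff) (metis (no_types, lifting) sum_le_suminf finite_lessThan
              divide_nonneg_pos zero_le_power mult_nonneg_nonneg abs_ge_zero less_imp_le fact_gt_zero)
        finally show ?thesis
          unfolding s using w[of u] True by (simp add: abs_mult mult_right_mono)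
      qed auto
    qed
  qed (use int meas intk in \<open>auto simp: set_integrable_def set_borel_measurable_def\<close>)
  also have "(\<lambda>n. \<integral>u. ?s n u \<partial>lborel) = (\<lambda>n. \<Sum>k<n. r ^ k / fact k * (LBINT u:A. u ^ k * w u))"
  proof
    fix n
    have "(\<integral>u. ?s n u \<partial>lborel) = (\<Sum>k<n. \<integral>u. indicator A u *\<^sub>R (r ^ k / fact k * (u ^ k * w u)) \<partial>lborel)"
      by (intro Bochner_Integration.integral_sum intk)
    also have "\<dots> = (\<Sum>k<n. r ^ k / fact k * (LBINT u:A. u ^ k * w u))"
      by (simp only: set_lebesgue_integral_def[symmetric] set_integral_mult_right)
    finally show "(\<integral>u. ?s n u \<partial>lborel) = (\<Sum>k<n. r ^ k / fact k * (LBINT u:A. u ^ k * w u))" .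
  qed
  finally show ?thesis by (simp add: sums_def)
qed

text \<open>The common coefficient of the three series in the theorem, with \<open>t = 2 * \<beta> / \<alpha>\<close> or its negative.\<close>
definition vg_coeff :: "real \<Rightarrow> real \<Rightarrow> nat \<Rightarrow> real" where
  "vg_coeff \<nu> t k = 1 / fact k * t ^ k * Gamma ((real k + 1) / 2) * Gamma (\<nu> + (real k + 1) / 2)"

lemma bessel_K_moment_eq_vg_coeff:
  "r ^ k / fact k * bessel_K_moment (\<nu> + real k) \<nu> = 2 powr (\<nu> - 1) * vg_coeff \<nu> (2 * r) k"
proof -
  have "(\<nu> + real k + \<nu> + 1) / 2 = \<nu> + (real k + 1) / 2" "(\<nu> + real k - \<nu> + 1) / 2 = (real k + 1) / 2"
    by (simp_all add: field_simps)
  moreover have "2 powr (\<nu> + real k - 1) = 2 powr (\<nu> - 1) * 2 ^ k"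
    using powr_add[of 2 "\<nu> - 1" "real k"] by (simp add: powr_realpow algebra_simps)
  ultimately show ?thesis
    unfolding bessel_K_moment_def vg_coeff_def by (simp only:) (simp add: power_mult_distrib)
qed

text \<open>The exponential series is applied to the density on the positive half line, where each term integrates to a
multiple of \<open>G\<close> or of \<open>1 - G\<close>. The constant \<open>c\<close> is arbitrary: the integrability of
\<open>exp (\<bar>r\<bar> * u) * u powr \<nu> * K \<nu> u\<close> that dominated convergence asks for follows from \<open>Y\<close> having this
density on both half lines, which contribute the two signs of the exponent. Intervals with either endpoint
included are treated together so that the statement can be applied to \<open>- Y\<close>, with \<open>- r\<close> for \<open>r\<close>, as well.\<close>
lemma std_vg_half_line_probabilities:
  fixes Y :: "'a \<Rightarrow> real" and c r \<nu> z :: real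
  assumes M: "prob_space M" and \<nu>: "\<nu> > -1/2" and c: "c > 0"
    and Y: "distributed M lborel Y (\<lambda>y. ennreal (c * (exp (r * y) * (\<bar>y\<bar> powr \<nu> * bessel_K \<nu> \<bar>y\<bar>))))"
    and z: "z \<ge> 0"
  shows "\<exists>S. (\<lambda>k. vg_coeff \<nu> (2 * r) k * G_tilde (\<nu> + real k) \<nu> z) sums S
            \<and> measure M {\<omega> \<in> space M. Y \<omega> > z} = c * 2 powr (\<nu> - 1) * S
            \<and> measure M {\<omega> \<in> space M. Y \<omega> \<ge> z} = c * 2 powr (\<nu> - 1) * S"
    and "\<exists>S. (\<lambda>k. vg_coeff \<nu> (2 * r) k * G_fun (\<nu> + real k) \<nu> z) sums S
            \<and> measure M {\<omega> \<in> space M. 0 < Y \<omega> \<and> Y \<omega> \<le> z} = c * 2 powr (\<nu> - 1) * S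
            \<and> measure M {\<omega> \<in> space M. 0 \<le> Y \<omega> \<and> Y \<omega> < z} = c * 2 powr (\<nu> - 1) * S"
proof -
  interpret prob_space M by (rule M)
  define w where "w = (\<lambda>u. u powr \<nu> * bessel_K \<nu> u)"
  define f where "f = (\<lambda>y. c * (exp (r * y) * w \<bar>y\<bar>))"
  have w0: "w u \<ge> 0" for u by (simp add: w_def bessel_K_nonneg)
  have f0: "f y \<ge> 0" for y using c w0 by (simp add: f_def)
  have Y: "distributed M lborel Y (\<lambda>y. ennreal (f y))"
    using Y by (simp add: f_def w_def)
  have f_meas [measurable]: "f \<in> borel_measurable lborel"
    using distributed_real_measurable[OF _ Y] f0 by simp
  have Y_meas [measurable]: "Y \<in> borel_measurable M"
    using Y by (simp add: distributed_def)
  \<comment> \<open>Integrability of the exponentially weighted terms comes from this density having mass 1.\<close>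
  have f_int: "integrable lborel f"
    using distributed_integrable[OF Y, of "\<lambda>_. 1"] f0 by simp
  have f_int_neg: "integrable lborel (\<lambda>y. f (- y))"
    using lborel_integrable_real_affine[OF f_int, of "-1" 0] by simp
  have w_int: "set_integrable lborel {0<..} (\<lambda>u. exp (r * u) * w u)"
              "set_integrable lborel {0<..} (\<lambda>u. exp (- r * u) * w u)"
  proof -
    have "integrable lborel (\<lambda>u. indicator {0<..} u *\<^sub>R (inverse c * f u))"
         "integrable lborel (\<lambda>u. indicator {0<..} u *\<^sub>R (inverse c * f (- u)))"
      by (intro integrable_mult_indicator integrable_mult_right f_int f_int_neg; simp)+
    moreover have "indicator {0<..} u *\<^sub>R (inverse c * f u) = indicator {0<..} u *\<^sub>R (exp (r * u) * w u)"
         "indicator {0<..} u *\<^sub>R (inverse c * f (- u)) = indicator {0<..} u *\<^sub>R (exp (- r * u) * w u)" for u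
      using c by (auto simp: f_def indicator_def)
    ultimately show "set_integrable lborel {0<..} (\<lambda>u. exp (r * u) * w u)"
              "set_integrable lborel {0<..} (\<lambda>u. exp (- r * u) * w u)"
      unfolding set_integrable_def by (simp_all only:)
  qed
  hence w_int_abs: "set_integrable lborel {0<..} (\<lambda>u. exp (\<bar>r\<bar> * u) * w u)"
    by (cases "r \<ge> 0") (simp_all add: abs_if)
  have power_w: "u ^ k * w u = u powr (\<nu> + real k) * bessel_K \<nu> u" if "u > 0" for u k
    using that by (simp add: w_def powr_add powr_realpow)
  have mom: "set_integrable lborel A (\<lambda>u. u ^ k * w u)"
    if "A \<in> sets borel" "A \<subseteq> {0<..}" for A k
  proof -
    have "set_integrable lborel {0<..} (\<lambda>u. u powr (\<nu> + real k) * bessel_K \<nu> u)"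
      using bessel_K_power_integral_Ioi(1)[of \<nu> "\<nu> + real k"] \<nu> by simp
    hence "set_integrable lborel A (\<lambda>u. u powr (\<nu> + real k) * bessel_K \<nu> u)"
      by (rule set_integrable_subset) (use that in auto)
    thus ?thesis
      using that by (subst set_integrable_cong[OF refl refl]) (auto simp: power_w)
  qed
  \<comment> \<open>Equality up to a null set lets intervals gain or lose endpoints.\<close>
  have prob_eq: "prob {\<omega> \<in> space M. Y \<omega> \<in> B} = c * (LBINT u:A. exp (r * u) * w u)"
    if A: "A \<in> sets borel" "A \<subseteq> {0<..}" and B: "B \<in> sets borel" and AB: "AE y in lborel. y \<in> B \<longleftrightarrow> y \<in> A" for A B
  proof -
    have "(\<integral>y. f y * indicator B y \<partial>lborel) = (\<integral>\<omega>. indicator B (Y \<omega>) \<partial>M)"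
      using B f0 by (intro distributed_integral[OF Y]) auto
    also have "\<dots> = (\<integral>\<omega>. indicator {\<omega> \<in> space M. Y \<omega> \<in> B} \<omega> \<partial>M)"
      by (intro Bochner_Integration.integral_cong) (auto simp: indicator_def)
    also have "\<dots> = prob {\<omega> \<in> space M. Y \<omega> \<in> B}" using B by simp
    finally have "prob {\<omega> \<in> space M. Y \<omega> \<in> B} = (\<integral>y. f y * indicator B y \<partial>lborel)" ..
    also have "\<dots> = (\<integral>y. f y * indicator A y \<partial>lborel)"
      using A B AB by (intro integral_cong_AE) (auto simp: indicator_def)
    also have "\<dots> = (\<integral>y. c * (indicator A y *\<^sub>R (exp (r * y) * w y)) \<partial>lborel)"
      using A by (intro Bochner_Integration.integral_cong) (auto simp: f_def indicator_def)
    also have "\<dots> = c * (LBINT u:A. exp (r * u) * w u)"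
      by (simp add: set_lebesgue_integral_def)
    finally show ?thesis .
  qed
  have sums: "(\<lambda>k. r ^ k / fact k * (LBINT u:A. u powr (\<nu> + real k) * bessel_K \<nu> u)) sums
                (LBINT u:A. exp (r * u) * w u)"
    if A: "A \<in> sets borel" "A \<subseteq> {0<..}" for A
  proof -
    have "(\<lambda>k. r ^ k / fact k * (LBINT u:A. u ^ k * w u)) sums (LBINT u:A. exp (r * u) * w u)"
    proof (rule exp_weighted_integral_sums[OF A w0 _ mom[OF A]])
      show "set_integrable lborel A (\<lambda>u. exp (\<bar>r\<bar> * u) * w u)"
        by (rule set_integrable_subset[OF w_int_abs]) (use A in auto)
      have "set_integrable lborel A (\<lambda>u. exp (r * u) * w u)"
        by (rule set_integrable_subset[OF w_int(1)]) (use A in auto)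
      thus "set_borel_measurable lborel A (\<lambda>u. exp (r * u) * w u)"
        unfolding set_borel_measurable_def set_integrable_def by (rule borel_measurable_integrable)
    qed
    also have "(\<lambda>k. r ^ k / fact k * (LBINT u:A. u ^ k * w u))
        = (\<lambda>k. r ^ k / fact k * (LBINT u:A. u powr (\<nu> + real k) * bessel_K \<nu> u))"
      using A by (intro ext arg_cong2[where f = "(*)"] refl set_lebesgue_integral_cong) (auto simp: power_w)
    finally show ?thesis .
  qed
  have coeff: "r ^ k / fact k * (bessel_K_moment (\<nu> + real k) \<nu> * g) = 2 powr (\<nu> - 1) * (vg_coeff \<nu> (2 * r) k * g)" for k g
    using bessel_K_moment_eq_vg_coeff[of r k \<nu>] by (metis mult.assoc)
  have scale: "\<exists>S. f sums S \<and> a = c * 2 powr (\<nu> - 1) * S \<and> b = c * 2 powr (\<nu> - 1) * S"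
    if "(\<lambda>k. 2 powr (\<nu> - 1) * f k) sums I" "a = c * I" "b = c * I" for f I a b
    using sums_mult[OF that(1), of "2 powr (1 - \<nu>)"] that(2,3)
    by (intro exI[of _ "2 powr (1 - \<nu>) * I"]) (simp add: mult.assoc[symmetric] flip: powr_add)
  show "\<exists>S. (\<lambda>k. vg_coeff \<nu> (2 * r) k * G_tilde (\<nu> + real k) \<nu> z) sums S
            \<and> prob {\<omega> \<in> space M. Y \<omega> > z} = c * 2 powr (\<nu> - 1) * S
            \<and> prob {\<omega> \<in> space M. Y \<omega> \<ge> z} = c * 2 powr (\<nu> - 1) * S"
  proof (rule scale)
    have "(\<lambda>k. r ^ k / fact k * (bessel_K_moment (\<nu> + real k) \<nu> * G_tilde (\<nu> + real k) \<nu> z)) sums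
            (LBINT u:{z<..}. exp (r * u) * w u)"
      using sums[of "{z<..}"] z \<nu> by (simp add: bessel_K_power_integral_tail_and_head subset_eq)
    thus "(\<lambda>k. 2 powr (\<nu> - 1) * (vg_coeff \<nu> (2 * r) k * G_tilde (\<nu> + real k) \<nu> z)) sums
            (LBINT u:{z<..}. exp (r * u) * w u)"
      unfolding coeff .
    show "prob {\<omega> \<in> space M. Y \<omega> > z} = c * (LBINT u:{z<..}. exp (r * u) * w u)"
      using prob_eq[of "{z<..}" "{z<..}"] z by (simp add: subset_eq)
    have "AE y in lborel. y \<in> {z..} \<longleftrightarrow> y \<in> {z<..}"
      by (rule eventually_mono[OF AE_lborel_singleton[of z]]) auto
    thus "prob {\<omega> \<in> space M. Y \<omega> \<ge> z} = c * (LBINT u:{z<..}. exp (r * u) * w u)"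
      using prob_eq[of "{z<..}" "{z..}"] z by (simp add: subset_eq)
  qed
  show "\<exists>S. (\<lambda>k. vg_coeff \<nu> (2 * r) k * G_fun (\<nu> + real k) \<nu> z) sums S
            \<and> prob {\<omega> \<in> space M. 0 < Y \<omega> \<and> Y \<omega> \<le> z} = c * 2 powr (\<nu> - 1) * S
            \<and> prob {\<omega> \<in> space M. 0 \<le> Y \<omega> \<and> Y \<omega> < z} = c * 2 powr (\<nu> - 1) * S"
  proof (rule scale)
    have "(\<lambda>k. r ^ k / fact k * (bessel_K_moment (\<nu> + real k) \<nu> * G_fun (\<nu> + real k) \<nu> z)) sums
            (LBINT u:{0<..z}. exp (r * u) * w u)"
      using sums[of "{0<..z}"] z \<nu> by (simp add: bessel_K_power_integral_tail_and_head subset_eq)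
    thus "(\<lambda>k. 2 powr (\<nu> - 1) * (vg_coeff \<nu> (2 * r) k * G_fun (\<nu> + real k) \<nu> z)) sums
            (LBINT u:{0<..z}. exp (r * u) * w u)"
      unfolding coeff .
    show "prob {\<omega> \<in> space M. 0 < Y \<omega> \<and> Y \<omega> \<le> z} = c * (LBINT u:{0<..z}. exp (r * u) * w u)"
      using prob_eq[of "{0<..z}" "{0<..z}"] z by (simp add: subset_eq)
    have "AE y in lborel. y \<in> {0..<z} \<longleftrightarrow> y \<in> {0<..z}"
      using AE_lborel_singleton[of z] AE_lborel_singleton[of "0::real"] by eventually_elim auto
    thus "prob {\<omega> \<in> space M. 0 \<le> Y \<omega> \<and> Y \<omega> < z} = c * (LBINT u:{0<..z}. exp (r * u) * w u)"
      using prob_eq[of "{0<..z}" "{0..<z}"] z by (simp add: subset_eq)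
  qed
qed

section \<open>The odd part of the coefficient series\<close>

lemma pochhammer_three_halves: "pochhammer (3/2 :: real) j = fact (2 * j + 1) / (4 ^ j * fact j)"
proof (induction j)
  case (Suc j)
  have "(fact (2 * Suc j + 1) :: real) = (2 * real j + 3) * ((2 * real j + 2) * fact (2 * j + 1))"
    by (simp add: algebra_simps)
  thus ?case
    by (simp add: pochhammer_Suc Suc field_simps del: fact_Suc) (simp add: field_simps)
qed auto

lemma vg_coeff_odd:
  fixes \<nu> r :: real
  assumes "\<nu> > -1/2"
  shows "vg_coeff \<nu> (2 * r) (2 * j + 1) = 2 * Gamma (\<nu> + 1) * r *
           (pochhammer 1 j * pochhammer (\<nu> + 1) j / pochhammer (3/2) j * ((r\<^sup>2) ^ j / fact j))"
proof -
  have half: "(real (2 * j + 1) + 1) / 2 = real j + 1" by simp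
  have G1: "Gamma (real j + 1) = fact j"
    using Gamma_fact[of j] by (simp add: add.commute)
  have G2: "Gamma (\<nu> + (real j + 1)) = Gamma (\<nu> + 1) * pochhammer (\<nu> + 1) j"
  proof -
    have pos: "\<nu> + 1 > 0" using assms by simp
    have "\<nu> + 1 \<notin> \<int>\<^sub>\<le>\<^sub>0"
      using pos by (auto elim!: nonpos_Ints_cases)
    moreover have "Gamma (\<nu> + 1) \<noteq> 0"
      using Gamma_real_pos[OF pos] by simp
    ultimately show ?thesis using pochhammer_Gamma[of "\<nu> + 1" j] by (simp add: field_simps)
  qed
  have pow: "(2 * r) ^ (2 * j + 1) = 2 * r * (4 ^ j * (r\<^sup>2) ^ j)"
    by (simp add: power_mult power_mult_distrib)
  show ?thesis
    unfolding vg_coeff_def half G1 G2 pow pochhammer_three_halves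
    by (simp add: pochhammer_fact[symmetric] del: fact_Suc)
qed

text \<open>Only the odd indices survive in the difference, and their terms are those of a Gaussian hypergeometric
series in \<open>r\<^sup>2\<close>.\<close>
lemma vg_coeff_odd_part_sums:
  fixes \<nu> r S T :: real
  assumes \<nu>: "\<nu> > -1/2"
    and S: "vg_coeff \<nu> (2 * r) sums S" and T: "vg_coeff \<nu> (2 * - r) sums T"
  shows "(S - T) / 2 = 2 * Gamma (\<nu> + 1) * r * hyp2F1 1 (\<nu> + 1) (3/2) (r\<^sup>2)"
proof (cases "r = 0")
  case True
  thus ?thesis using sums_unique2[OF S] T by simp
next
  case False
  let ?h = "\<lambda>j. pochhammer 1 j * pochhammer (\<nu> + 1) j / pochhammer (3/2) j * ((r\<^sup>2) ^ j / fact j)"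
  let ?f = "\<lambda>k. (vg_coeff \<nu> (2 * r) k - vg_coeff \<nu> (2 * - r) k) / 2"
  have f: "?f k = (if odd k then vg_coeff \<nu> (2 * r) k else 0)" for k
    using power_minus[of "2 * r" k] by (simp add: vg_coeff_def)
  have "?f sums ((S - T) / 2)" by (intro sums_divide sums_diff S T)
  hence "(\<lambda>j. ?f (2 * j + 1)) sums ((S - T) / 2)"
  proof (subst sums_mono_reindex)
    show "strict_mono (\<lambda>j::nat. 2 * j + 1)" by (simp add: strict_mono_def)
    show "?f k = 0" if "k \<notin> range (\<lambda>j. 2 * j + 1)" for k
      unfolding f using that by (auto elim!: oddE)
  qed
  moreover define K where "K = 2 * Gamma (\<nu> + 1) * r"
  have "?f (2 * j + 1) = K * ?h j" for j
    using vg_coeff_odd[OF \<nu>, of r j] unfolding f K_def by simp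
  ultimately have "(\<lambda>j. K * ?h j) sums ((S - T) / 2)" by (simp only:)
  from sums_divide[OF this, of K]
  have "(\<lambda>j. K * ?h j / K) sums ((S - T) / 2 / K)" .
  moreover have "Gamma (\<nu> + 1) > 0" using \<nu> by (intro Gamma_real_pos) simp
  hence K: "K \<noteq> 0" using False by (simp add: K_def)
  ultimately have "?h sums ((S - T) / 2 / K)" using K by simp
  hence "hyp2F1 1 (\<nu> + 1) (3/2) (r\<^sup>2) = (S - T) / 2 / K"
    unfolding hyp2F1_def by (simp only: sums_iff)
  thus ?thesis using K unfolding K_def[symmetric] by simp
qed

section \<open>The distribution function\<close>

text \<open>The density of \<open>\<alpha> * (X - \<mu>)\<close>; only \<open>r = \<beta> / \<alpha>\<close> remains of the scale and skewness parameters.\<close>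
definition std_vg_density :: "real \<Rightarrow> real \<Rightarrow> real \<Rightarrow> real" where
  "std_vg_density \<nu> r y = (1 - r\<^sup>2) powr (\<nu> + 1/2) / (sqrt pi * 2 powr \<nu> * Gamma (\<nu> + 1/2))
     * (exp (r * y) * (\<bar>y\<bar> powr \<nu> * bessel_K \<nu> \<bar>y\<bar>))"

text \<open>The powers of \<open>\<alpha>\<close> balance: \<open>2 * \<nu> + 1\<close> in the numerator against one \<open>\<nu>\<close> from the normalising constant,
one from the rescaled argument, and the Jacobian.\<close>
lemma vg_density_rescale:
  fixes \<alpha> \<beta> \<mu> \<nu> y :: real
  assumes "\<bar>\<beta>\<bar> < \<alpha>"
  shows "vg_density \<nu> \<alpha> \<beta> \<mu> ((y + \<alpha> * \<mu>) / \<alpha>) / \<alpha> = std_vg_density \<nu> (\<beta> / \<alpha>) y"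
proof -
  have \<alpha>: "\<alpha> > 0" using assms by linarith
  have r: "1 - (\<beta> / \<alpha>)\<^sup>2 \<ge> 0"
    using assms abs_le_square_iff[of \<beta> \<alpha>] by (simp add: power_divide)
  have "\<alpha>\<^sup>2 - \<beta>\<^sup>2 = \<alpha>\<^sup>2 * (1 - (\<beta> / \<alpha>)\<^sup>2)"
    using \<alpha> by (simp add: power_divide right_diff_distrib)
  moreover have "\<alpha>\<^sup>2 powr (\<nu> + 1/2) = \<alpha> powr \<nu> * \<alpha> powr \<nu> * \<alpha>"
  proof -
    have "\<alpha>\<^sup>2 = \<alpha> powr 2" using \<alpha> by simp
    hence "\<alpha>\<^sup>2 powr (\<nu> + 1/2) = \<alpha> powr (\<nu> + \<nu> + 1)"
      by (simp only: powr_powr) (simp add: algebra_simps)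
    thus ?thesis using \<alpha> by (simp only: powr_add) simp
  qed
  ultimately have 1: "(\<alpha>\<^sup>2 - \<beta>\<^sup>2) powr (\<nu> + 1/2)
      = \<alpha> powr \<nu> * \<alpha> powr \<nu> * \<alpha> * (1 - (\<beta> / \<alpha>)\<^sup>2) powr (\<nu> + 1/2)"
    using \<alpha> r by (simp add: powr_mult)
  have shift: "(y + \<alpha> * \<mu>) / \<alpha> - \<mu> = y / \<alpha>"
    using \<alpha> by (simp add: field_simps)
  have 2: "\<bar>y / \<alpha>\<bar> powr \<nu> = \<bar>y\<bar> powr \<nu> / \<alpha> powr \<nu>"
    using \<alpha> by (simp add: powr_divide)
  have 3: "(2 * \<alpha>) powr \<nu> = 2 powr \<nu> * \<alpha> powr \<nu>"
    using \<alpha> by (simp add: powr_mult)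
  have 4: "\<alpha> * \<bar>y / \<alpha>\<bar> = \<bar>y\<bar>" using \<alpha> by simp
  have cancel: "a * a * \<alpha> * P / (p * (t * a) * g) * e * (v / a) * k / \<alpha> = P / (p * t * g) * (e * (v * k))"
    if "a \<noteq> 0" for a P p t g e v k :: real
    using that \<alpha> by simp
  show ?thesis
    unfolding vg_density_def std_vg_density_def shift 1 2 3 4
    using cancel[of "\<alpha> powr \<nu>"] \<alpha> by simp
qed

lemma vg_density_nonneg:
  assumes "\<nu> > -1/2"
  shows "vg_density \<nu> \<alpha> \<beta> \<mu> x \<ge> 0"
proof -
  have "Gamma (\<nu> + 1/2) > 0" using assms by (intro Gamma_real_pos) simp
  thus ?thesis by (simp add: vg_density_def bessel_K_nonneg)
qed

theorem theorem2p1: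
  fixes M :: "'a measure" and X :: "'a \<Rightarrow> real" and \<nu> \<alpha> \<beta> \<mu> :: real
  assumes "prob_space M"
    and "\<nu> > -1/2" and "0 \<le> \<bar>\<beta>\<bar>" and "\<bar>\<beta>\<bar> < \<alpha>"
    and "VG_distributed M X \<nu> \<alpha> \<beta> \<mu>"
  shows
    "(\<forall>x\<ge>\<mu>. \<exists>S.
        (\<lambda>k. 1 / fact k * (2 * \<beta> / \<alpha>) ^ k * Gamma ((real k + 1) / 2)
              * Gamma (\<nu> + (real k + 1) / 2) * G_tilde (\<nu> + real k) \<nu> (\<alpha> * (x - \<mu>))) sums S
        \<and> measure M {\<omega> \<in> space M. X \<omega> \<le> x}
            = 1 - (1 - \<beta>\<^sup>2 / \<alpha>\<^sup>2) powr (\<nu> + 1/2) / (2 * sqrt pi * Gamma (\<nu> + 1/2)) * S)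
   \<and> (\<forall>x<\<mu>. \<exists>S.
        (\<lambda>k. (-1) ^ k / fact k * (2 * \<beta> / \<alpha>) ^ k * Gamma ((real k + 1) / 2)
              * Gamma (\<nu> + (real k + 1) / 2) * G_tilde (\<nu> + real k) \<nu> (- \<alpha> * (x - \<mu>))) sums S
        \<and> measure M {\<omega> \<in> space M. X \<omega> \<le> x}
            = (1 - \<beta>\<^sup>2 / \<alpha>\<^sup>2) powr (\<nu> + 1/2) / (2 * sqrt pi * Gamma (\<nu> + 1/2)) * S)
   \<and> (\<forall>x. \<exists>S.
        (\<lambda>k. sgn (x - \<mu>) ^ (k + 1) / fact k * (2 * \<beta> / \<alpha>) ^ k * Gamma ((real k + 1) / 2)
              * Gamma (\<nu> + (real k + 1) / 2) * G_fun (\<nu> + real k) \<nu> (\<alpha> * \<bar>x - \<mu>\<bar>)) sums S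
        \<and> measure M {\<omega> \<in> space M. X \<omega> \<le> x}
            = 1/2
              - Gamma (\<nu> + 1) / (sqrt pi * Gamma (\<nu> + 1/2)) * (\<beta> / \<alpha>)
                * (1 - \<beta>\<^sup>2 / \<alpha>\<^sup>2) powr (\<nu> + 1/2) * hyp2F1 1 (\<nu> + 1) (3/2) (\<beta>\<^sup>2 / \<alpha>\<^sup>2)
              + (1 - \<beta>\<^sup>2 / \<alpha>\<^sup>2) powr (\<nu> + 1/2) / (2 * sqrt pi * Gamma (\<nu> + 1/2)) * S)"
proof -
  interpret prob_space M by fact
  have \<nu>: "\<nu> > -1/2" by fact
  have \<alpha>: "\<alpha> > 0" and \<beta>: "\<bar>\<beta>\<bar> < \<alpha>" using assms(4) by linarith+
  define r where "r = \<beta> / \<alpha>"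
  define Y where "Y = (\<lambda>\<omega>. \<alpha> * (X \<omega> - \<mu>))"
  define c where "c = (1 - r\<^sup>2) powr (\<nu> + 1/2) / (sqrt pi * 2 powr \<nu> * Gamma (\<nu> + 1/2))"
  define C where "C = (1 - r\<^sup>2) powr (\<nu> + 1/2) / (2 * sqrt pi * Gamma (\<nu> + 1/2))"
  have r2: "\<beta>\<^sup>2 / \<alpha>\<^sup>2 = r\<^sup>2" "2 * \<beta> / \<alpha> = 2 * r" by (simp_all add: r_def power_divide)
  have "\<bar>r\<bar> < 1" using \<alpha> \<beta> by (simp add: r_def)
  hence "r\<^sup>2 < 1" by (simp add: abs_square_less_1)
  moreover have "Gamma (\<nu> + 1/2) > 0" using \<nu> by (intro Gamma_real_pos) auto
  ultimately have c: "c > 0" by (simp add: c_def)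
  have C: "C = c * 2 powr (\<nu> - 1)"
    by (simp add: C_def c_def powr_diff)

  have distX: "distributed M lborel X (\<lambda>x. ennreal (vg_density \<nu> \<alpha> \<beta> \<mu> x))"
    using assms(5) by (simp add: VG_distributed_def)
  have "distributed M lborel (\<lambda>\<omega>. - (\<alpha> * \<mu>) + \<alpha> * X \<omega>)
          (\<lambda>y. ennreal (vg_density \<nu> \<alpha> \<beta> \<mu> ((y - - (\<alpha> * \<mu>)) / \<alpha>)) / ennreal \<bar>\<alpha>\<bar>)"
    using \<alpha> by (intro distributed_affine[OF distX]) simp
  also have "(\<lambda>y. ennreal (vg_density \<nu> \<alpha> \<beta> \<mu> ((y - - (\<alpha> * \<mu>)) / \<alpha>)) / ennreal \<bar>\<alpha>\<bar>)
      = (\<lambda>y. ennreal (std_vg_density \<nu> r y))"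
    using \<alpha> \<beta> \<nu> by (simp add: r_def divide_ennreal vg_density_nonneg vg_density_rescale)
  also have "(\<lambda>\<omega>. - (\<alpha> * \<mu>) + \<alpha> * X \<omega>) = Y"
    by (simp add: Y_def algebra_simps)
  finally have distY: "distributed M lborel Y (\<lambda>y. ennreal (std_vg_density \<nu> r y))" .
  from distributed_affine[OF distY, of "-1" 0]
  have distY': "distributed M lborel (\<lambda>\<omega>. - Y \<omega>) (\<lambda>y. ennreal (std_vg_density \<nu> (- r) y))"
    by (simp add: std_vg_density_def divide_ennreal_def)
  have [measurable]: "Y \<in> borel_measurable M" using distY by (simp add: distributed_def)
  note pos = std_vg_half_line_probabilities[OF prob_space_axioms \<nu> c, of Y r]
  note neg = std_vg_half_line_probabilities[OF prob_space_axioms \<nu> c, of "\<lambda>\<omega>. - Y \<omega>" "- r"]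
  note pos = pos[OF distY[unfolded std_vg_density_def, folded c_def], folded C]
  note neg = neg[OF distY'[unfolded std_vg_density_def power2_minus, folded c_def], folded C]

  have X_le: "{\<omega> \<in> space M. X \<omega> \<le> x} = {\<omega> \<in> space M. Y \<omega> \<le> \<alpha> * (x - \<mu>)}" for x
    using \<alpha> by (auto simp: Y_def)
  have compl: "prob {\<omega> \<in> space M. Y \<omega> \<le> z} = 1 - prob {\<omega> \<in> space M. Y \<omega> > z}" for z
  proof -
    have "prob {\<omega> \<in> space M. \<not> (Y \<omega> > z)} = 1 - prob {\<omega> \<in> space M. Y \<omega> > z}"
      by (intro prob_neg) measurable
    thus ?thesis by (simp add: not_less)
  qed

  have i: "\<exists>S. (\<lambda>k. vg_coeff \<nu> (2 * r) k * G_tilde (\<nu> + real k) \<nu> z) sums S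
              \<and> prob {\<omega> \<in> space M. Y \<omega> \<le> z} = 1 - C * S" if "z \<ge> 0" for z
    using pos(1)[OF that] compl[of z] by auto
  have ii: "\<exists>S. (\<lambda>k. vg_coeff \<nu> (2 * - r) k * G_tilde (\<nu> + real k) \<nu> z) sums S
              \<and> prob {\<omega> \<in> space M. Y \<omega> \<le> - z} = C * S" if "z \<ge> 0" for z
    using neg(1)[OF that] by (simp add: le_minus_iff) blast

  \<comment> \<open>Both expansions at \<open>\<mu>\<close>, from the right and from the left, compute the same probability.\<close>
  obtain S where S: "vg_coeff \<nu> (2 * r) sums S" "prob {\<omega> \<in> space M. Y \<omega> \<le> 0} = 1 - C * S"
    using i[of 0] by (auto simp: G_tilde_def G_fun_def)
  obtain T where T: "vg_coeff \<nu> (2 * - r) sums T" "prob {\<omega> \<in> space M. Y \<omega> \<le> 0} = C * T"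
    using ii[of 0] by (auto simp: G_tilde_def G_fun_def)
  define D where "D = Gamma (\<nu> + 1) / (sqrt pi * Gamma (\<nu> + 1/2)) * r
                * (1 - r\<^sup>2) powr (\<nu> + 1/2) * hyp2F1 1 (\<nu> + 1) (3/2) (r\<^sup>2)"
  have D: "D = C * ((S - T) / 2)"
    unfolding D_def C_def vg_coeff_odd_part_sums[OF \<nu> S(1) T(1)] by simp
  \<comment> \<open>The even part of the series is fixed by \<open>1 - C * S = C * T\<close>, so only the odd part \<open>(S - T) / 2\<close> remains.\<close>
  have P0: "prob {\<omega> \<in> space M. Y \<omega> \<le> 0} = 1/2 - D"
    using S(2) T(2) unfolding D by (simp add: field_simps)

  have iii_pos: "\<exists>S. (\<lambda>k. vg_coeff \<nu> (2 * r) k * G_fun (\<nu> + real k) \<nu> z) sums S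
              \<and> prob {\<omega> \<in> space M. Y \<omega> \<le> z} = 1/2 - D + C * S" if z: "z \<ge> 0" for z
  proof -
    have "{\<omega> \<in> space M. Y \<omega> \<le> z} = {\<omega> \<in> space M. Y \<omega> \<le> 0} \<union> {\<omega> \<in> space M. 0 < Y \<omega> \<and> Y \<omega> \<le> z}"
      using z by auto
    hence "prob {\<omega> \<in> space M. Y \<omega> \<le> z} = prob {\<omega> \<in> space M. Y \<omega> \<le> 0} + prob {\<omega> \<in> space M. 0 < Y \<omega> \<and> Y \<omega> \<le> z}"
      by (simp only:) (intro finite_measure_Union; auto)
    thus ?thesis using pos(2)[OF z] P0 by auto
  qed
  have iii_neg: "\<exists>S. (\<lambda>k. vg_coeff \<nu> (2 * - r) k * G_fun (\<nu> + real k) \<nu> z) sums S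
              \<and> prob {\<omega> \<in> space M. Y \<omega> \<le> - z} = 1/2 - D - C * S" if z: "z \<ge> 0" for z
  proof -
    have "{\<omega> \<in> space M. Y \<omega> \<le> 0} = {\<omega> \<in> space M. Y \<omega> \<le> - z} \<union> {\<omega> \<in> space M. 0 \<le> - Y \<omega> \<and> - Y \<omega> < z}"
      using z by auto
    hence "prob {\<omega> \<in> space M. Y \<omega> \<le> 0} = prob {\<omega> \<in> space M. Y \<omega> \<le> - z} + prob {\<omega> \<in> space M. 0 \<le> - Y \<omega> \<and> - Y \<omega> < z}"
      by (simp only:) (intro finite_measure_Union; auto)
    thus ?thesis using neg(2)[OF z] P0 by auto
  qed

  show ?thesis
    unfolding r2 r_def[symmetric] C_def[symmetric] D_def[symmetric] X_le
  proof (intro conjI allI impI)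
    fix x :: real
    {
      assume "x \<ge> \<mu>"
      thus "\<exists>S. (\<lambda>k. 1 / fact k * (2 * r) ^ k * Gamma ((real k + 1) / 2)
              * Gamma (\<nu> + (real k + 1) / 2) * G_tilde (\<nu> + real k) \<nu> (\<alpha> * (x - \<mu>))) sums S
        \<and> prob {\<omega> \<in> space M. Y \<omega> \<le> \<alpha> * (x - \<mu>)} = 1 - C * S"
        using i[of "\<alpha> * (x - \<mu>)"] \<alpha> unfolding vg_coeff_def by simp
    next
      assume "x < \<mu>"
      hence z: "- \<alpha> * (x - \<mu>) \<ge> 0" using \<alpha> by (simp add: mult_le_0_iff)
      have coeff: "(- 1) ^ k / fact k * (2 * r) ^ k * Gamma ((real k + 1) / 2) * Gamma (\<nu> + (real k + 1) / 2)
                    = vg_coeff \<nu> (2 * - r) k" for k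
        using power_minus[of "2 * r" k] by (simp add: vg_coeff_def)
      show "\<exists>S. (\<lambda>k. (- 1) ^ k / fact k * (2 * r) ^ k * Gamma ((real k + 1) / 2)
              * Gamma (\<nu> + (real k + 1) / 2) * G_tilde (\<nu> + real k) \<nu> (- \<alpha> * (x - \<mu>))) sums S
        \<and> prob {\<omega> \<in> space M. Y \<omega> \<le> \<alpha> * (x - \<mu>)} = C * S"
        using ii[OF z] unfolding coeff by simp
    }
    show "\<exists>S. (\<lambda>k. sgn (x - \<mu>) ^ (k + 1) / fact k * (2 * r) ^ k * Gamma ((real k + 1) / 2)
              * Gamma (\<nu> + (real k + 1) / 2) * G_fun (\<nu> + real k) \<nu> (\<alpha> * \<bar>x - \<mu>\<bar>)) sums S
        \<and> prob {\<omega> \<in> space M. Y \<omega> \<le> \<alpha> * (x - \<mu>)} = 1/2 - D + C * S"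
    proof (cases "x \<ge> \<mu>")
      case True
      have "sgn (x - \<mu>) ^ (k + 1) / fact k * (2 * r) ^ k * Gamma ((real k + 1) / 2)
              * Gamma (\<nu> + (real k + 1) / 2) * G_fun (\<nu> + real k) \<nu> (\<alpha> * \<bar>x - \<mu>\<bar>)
            = vg_coeff \<nu> (2 * r) k * G_fun (\<nu> + real k) \<nu> (\<alpha> * (x - \<mu>))" for k
        \<comment> \<open>At \<open>x = \<mu>\<close> the sign is 0, and so is \<open>G\<close>; both series vanish termwise.\<close>
        using True by (cases "x = \<mu>") (simp_all add: vg_coeff_def G_fun_def)
      thus ?thesis using iii_pos[of "\<alpha> * (x - \<mu>)"] \<alpha> True by simp
    next
      case False
      define z where "z = \<alpha> * \<bar>x - \<mu>\<bar>"
      have z: "z \<ge> 0" "\<alpha> * (x - \<mu>) = - z" using \<alpha> False by (simp_all add: z_def algebra_simps)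
      have coeff: "sgn (x - \<mu>) ^ (k + 1) / fact k * (2 * r) ^ k * Gamma ((real k + 1) / 2)
              * Gamma (\<nu> + (real k + 1) / 2) * g = - (vg_coeff \<nu> (2 * - r) k * g)" for k g
        using False power_minus[of "2 * r" k] by (simp add: vg_coeff_def)
      obtain S where "(\<lambda>k. vg_coeff \<nu> (2 * - r) k * G_fun (\<nu> + real k) \<nu> z) sums S"
          "prob {\<omega> \<in> space M. Y \<omega> \<le> - z} = 1/2 - D - C * S"
        using iii_neg[OF z(1)] by blast
      thus ?thesis unfolding z_def[symmetric] z(2) coeff
        by (intro exI[of _ "- S"] conjI sums_minus) simp_all
    qed
  qed
qed

end
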